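(* There exists a constant $C_{FI}$ depending only on $\Omega,\alpha,\kappa,T,\Psi_i,\eta_i,\theta_i,\zeta$ and $c_1^0$ such that every solution $(\boldsymbol{c}^n,\boldsymbol{\mu}^n)_{1\le n\le N}$ to the finite volume scheme described in the context satisfies $$\sum_{n=1}^N\Delta t\sum_{K\in\mathcal{T}}m_K\Big(\frac1{m_K}\sum_{\sigma=K|L\in\mathcal{E}_{K,\rm int}}\tau_\sigma(c_{1,K}^n-c_{1,L}^n)\Big)^2+\sum_{n=1}^N\Delta t\sum_{i\in\{1,2\}}\eta_i\theta_{i,\mathcal{T}}\sum_{\sigma=K|L\in\mathcal{E}_{\rm int}}\tau_\sigma(c_{i,K}^n-c_{i,L}^n)\big(\log c_{i,K}^n-\log c_{i,L}^n\big)\le C_{FI}.$$ As a consequence, there exists a constant $C$ depending only on $\Omega,\alpha,\kappa,T,\Psi_i,\eta_i,\theta_i,\zeta$ and $c_1^0$ such that $$\sum_{n=1}^N\Delta t\sum_{K\in\mathcal{T}}m_K\big(\mu_{1,K}^n-\mu_{2,K}^n\big)^2\le C.$$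
   Context: **Data.** $\Omega\subset\mathbb{R}^2$ is a bounded connected polygonal open set, $T>0$, $\alpha,\kappa>0$, and for $i\in\{1,2\}$: $\eta_i>0$, $\theta_i\ge0$, $\Psi_i\in H^1(\Omega)$, $c_i^0\in H^1(\Omega)$ with $c_i^0\ge0$, $c_1^0+c_2^0=1$ in $\Omega$, $\int_\Omega c_i^0\,d\boldsymbol{x}>0$. The scheme also involves a numerical parameter $\rho>0$ fixed by the user. **Admissible mesh.** A triplet $(\mathcal{T},\mathcal{E},(\boldsymbol{x}_K)_{K\in\mathcal{T}})$ such that: (i) each cell $K\in\mathcal{T}$ is non-empty, open, polygonal, convex; cells are pairwise disjoint and $\bigcup_K\overline K=\overline\Omega$; $m_K$ is the area of $K$. (ii) Each edge $\sigma\in\mathcal{E}$ is closed, contained in a line, with length $m_\sigma>0$; distinct edges intersect in a set of zero 1-dimensional Hausdorff measure; for each $K$ there is $\mathcal{E}_K\subset\mathcal{E}$ with $\partial K=\bigcup_{\sigma\in\mathcal{E}_K}\sigma$, and $\bigcup_K\mathcal{E}_K=\mathcal{E}$; for $K\ne L$, $\overline K\cap\overline L$ is either a single edge denoted $K|L$ or has zero 1-dimensional measure. (iii) The centers $\boldsymbol{x}_K\in K$ are pairwise distinct, and if $K,L$ share an edge $K|L$, then $\boldsymbol{n}_{KL}=\frac{\boldsymbol{x}_L-\boldsymbol{x}_K}{|\boldsymbol{x}_K-\boldsymbol{x}_L|}$ is orthogonal to $K|L$. (iv) For $\sigma=K|L$, the line joining $\boldsymbol{x}_K$ and $\boldsymbol{x}_L$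 crosses $\sigma$ at its midpoint $\boldsymbol{x}_\sigma$. Notation: $h_K=\mathrm{diam}(K)$, $h_{\mathcal{T}}=\max_Kh_K$; for $\sigma=K|L$, $d_\sigma=|\boldsymbol{x}_K-\boldsymbol{x}_L|$, $d_{K\sigma}=|\boldsymbol{x}_K-\boldsymbol{x}_\sigma|$, $\tau_\sigma=m_\sigma/d_\sigma$; $\mathcal{E}_{K,\rm int}$ is the set of $\sigma\in\mathcal{E}_K$ of the form $K|L$, and $\mathcal{E}_{\rm int}=\bigcup_K\mathcal{E}_{K,\rm int}$. **Mesh regularity parameter.** $\zeta>1$ is a finite number such that $d_{K\sigma}\ge d_\sigma/\zeta$ for all $K\in\mathcal{T}$, $\sigma\in\mathcal{E}_{K,\rm int}$, and $m_K\ge h_K^2/\zeta$ for all $K\in\mathcal{T}$. **Scheme.** $\Delta t=T/N$ with $N\ge 1$ an integer, $t^n=n\Delta t$, $\Psi_{i,K}=\frac1{m_K}\int_K\Psi_i\,d\boldsymbol{x}$, $\theta_{i,\mathcal{T}}=\max(\theta_i,\rho h_{\mathcal{T}})$. The initial values are $c_{i,K}^0=\frac1{m_K}\int_Kc_i^0\,d\boldsymbol{x}$. A solution is a family $\boldsymbol{c}^n=(c_{1,K}^n,c_{2,K}^n)_{K\in\mathcal{T}}$, $\boldsymbol{\mu}^n=(\mu_{1,K}^n,\mu_{2,K}^n)_{K\in\mathcal{T}}$, $1\le n\le N$, such that for all $n\in\{1,\dots,N\}$, $K\in\mathcal{T}$, $i\in\{1,2\}$: $$m_K\frac{c_{i,K}^n-c_{i,K}^{n-1}}{\Delta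 t}+\sum_{\sigma=K|L\in\mathcal{E}_{K,\rm int}}\tau_\sigma\Big[\frac{c_{i,\sigma}^n}{\eta_i}(\mu_{i,K}^n+\Psi_{i,K}-\mu_{i,L}^n-\Psi_{i,L})+\theta_{i,\mathcal{T}}(c_{i,K}^n-c_{i,L}^n)\Big]=0,$$ $$\mu_{1,K}^n-\mu_{2,K}^n=\frac{\alpha}{m_K}\sum_{\sigma=K|L\in\mathcal{E}_{K,\rm int}}\tau_\sigma(c_{1,K}^n-c_{1,L}^n)+\kappa(1-2c_{1,K}^{n-1}),$$ $$c_{1,K}^n+c_{2,K}^n=1,\qquad \sum_{K\in\mathcal{T}}m_K\overline\mu_K^n=0\ \text{ with }\ \overline\mu_K^n=c_{1,K}^n\mu_{1,K}^n+c_{2,K}^n\mu_{2,K}^n.$$ Here, for $\sigma=K|L$, $c_{i,\sigma}^n=c_{i,K}^n$ if $c_{i,K}^n=c_{i,L}^n\ge0$; $c_{i,\sigma}^n=0$ if $\min(c_{i,K}^n,c_{i,L}^n)\le0$; and $c_{i,\sigma}^n=\frac{c_{i,K}^n-c_{i,L}^n}{\log c_{i,K}^n-\log c_{i,L}^n}$ otherwise. (Every solution satisfies $0<c_{i,K}^n<1$ for $n\ge1$, so the logarithms make sense.) *)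

theory Defs
  imports "HOL-Analysis.Analysis"
begin

type_synonym plane = "real^2"

text \<open>Finite unions of polytopes may be non-convex and have holes, but the interior of such a union
  has no slits or isolated boundary points. In particular \<Omega> is the interior of its closure.\<close>

definition polygonal :: "plane set \<Rightarrow> bool" where
  "polygonal S \<longleftrightarrow> (\<exists>P. finite P \<and> (\<forall>p\<in>P. polytope p) \<and> S = interior (\<Union>P))"

definition hausdorff1 :: "plane set \<Rightarrow> ennreal" where
  "hausdorff1 A = (SUP \<delta>\<in>{0<..}. INF U\<in>{U :: nat \<Rightarrow> plane set. A \<subseteq> (\<Union>j. U j) \<and>
      (\<forall>j. bounded (U j) \<and> diameter (U j) \<le> \<delta>)}. \<Sum>j. ennreal (diameter (U j)))"


subsection \<open>The Sobolev space \<open>H\<^sup>1(\<Omega>)\<close>\<close>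

primrec cont_diff :: "nat \<Rightarrow> (plane \<Rightarrow> real) \<Rightarrow> bool" where
  "cont_diff 0 f \<longleftrightarrow> continuous_on UNIV f"
| "cont_diff (Suc k) f \<longleftrightarrow> (\<forall>x. f differentiable (at x)) \<and>
     (\<forall>v. cont_diff k (\<lambda>x. frechet_derivative f (at x) v))"

definition test_function :: "plane set \<Rightarrow> (plane \<Rightarrow> real) \<Rightarrow> bool" where
  "test_function \<Omega> \<phi> \<longleftrightarrow> (\<forall>k. cont_diff k \<phi>) \<and>
     compact (closure {x. \<phi> x \<noteq> 0}) \<and> closure {x. \<phi> x \<noteq> 0} \<subseteq> \<Omega>"

definition L2 :: "plane set \<Rightarrow> (plane \<Rightarrow> real) \<Rightarrow> bool" where
  "L2 \<Omega> f \<longleftrightarrow> set_borel_measurable lebesgue \<Omega> f \<and> set_integrable lebesgue \<Omega> (\<lambda>x. (f x)\<^sup>2)"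

definition H1 :: "plane set \<Rightarrow> (plane \<Rightarrow> real) \<Rightarrow> bool" where
  "H1 \<Omega> f \<longleftrightarrow> L2 \<Omega> f \<and> (\<exists>g :: 2 \<Rightarrow> plane \<Rightarrow> real. \<forall>j. L2 \<Omega> (g j) \<and>
     (\<forall>\<phi>. test_function \<Omega> \<phi> \<longrightarrow>
        (LINT x:\<Omega>|lebesgue. f x * frechet_derivative \<phi> (at x) (axis j 1))
          = - (LINT x:\<Omega>|lebesgue. g j x * \<phi> x)))"

definition initial_data :: "plane set \<Rightarrow> (nat \<Rightarrow> plane \<Rightarrow> real) \<Rightarrow> bool" where
  "initial_data \<Omega> c0 \<longleftrightarrow>
     (\<forall>i\<in>{1,2}. H1 \<Omega> (c0 i) \<and> (AE x\<in>\<Omega> in lebesgue. c0 i x \<ge> 0) \<and>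
        (LINT x:\<Omega>|lebesgue. c0 i x) > 0) \<and>
     (AE x\<in>\<Omega> in lebesgue. c0 1 x + c0 2 x = 1)"


subsection \<open>Admissible meshes\<close>

text \<open>\<open>cell_edges\<close> is the assignment of \<open>\<E>\<^sub>K\<close> to \<open>K\<close>; it is determined by the other fields
  on admissible meshes.\<close>

record mesh =
  cells :: "plane set set"
  edges :: "plane set set"
  cell_edges :: "plane set \<Rightarrow> plane set set"
  center :: "plane set \<Rightarrow> plane"

abbreviation area :: "plane set \<Rightarrow> real" where
  "area K \<equiv> measure lebesgue K"

definition edge_length :: "plane set \<Rightarrow> real" where
  "edge_length \<sigma> = enn2real (hausdorff1 \<sigma>)"

text \<open>Only meaningful for segments; an edge of the form \<open>K|L\<close> is a compact convex subset of a line.\<close>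

definition edge_midpoint :: "plane set \<Rightarrow> plane" where
  "edge_midpoint \<sigma> = (THE m. \<exists>a b. \<sigma> = closed_segment a b \<and> m = midpoint a b)"

text \<open>The edge \<open>\<sigma>\<close> is \<open>K|L\<close>.\<close>

definition is_interface :: "mesh \<Rightarrow> plane set \<Rightarrow> plane set \<Rightarrow> plane set \<Rightarrow> bool" where
  "is_interface M \<sigma> K L \<longleftrightarrow> K \<in> cells M \<and> L \<in> cells M \<and> K \<noteq> L \<and> \<sigma> \<in> edges M \<and>
     \<sigma> = closure K \<inter> closure L"

definition unit_normal :: "mesh \<Rightarrow> plane set \<Rightarrow> plane set \<Rightarrow> plane" where
  "unit_normal M K L = (center M L - center M K) /\<^sub>R norm (center M K - center M L)"

definition admissible_mesh :: "plane set \<Rightarrow> mesh \<Rightarrow> bool" where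
  "admissible_mesh \<Omega> M \<longleftrightarrow>
     finite (cells M) \<and> finite (edges M) \<and>
     (\<forall>K\<in>cells M. K \<noteq> {} \<and> open K \<and> polygonal K \<and> convex K) \<and>
     pairwise disjnt (cells M) \<and>
     (\<Union>K\<in>cells M. closure K) = closure \<Omega> \<and>
     (\<forall>\<sigma>\<in>edges M. closed \<sigma> \<and> collinear \<sigma> \<and> edge_length \<sigma> > 0) \<and>
     (\<forall>\<sigma>\<in>edges M. \<forall>\<sigma>'\<in>edges M. \<sigma> \<noteq> \<sigma>' \<longrightarrow> hausdorff1 (\<sigma> \<inter> \<sigma>') = 0) \<and>
     (\<forall>K\<in>cells M. cell_edges M K \<subseteq> edges M \<and> frontier K = \<Union>(cell_edges M K)) \<and>
     (\<Union>K\<in>cells M. cell_edges M K) = edges M \<and>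
     (\<forall>K\<in>cells M. \<forall>L\<in>cells M. K \<noteq> L \<longrightarrow>
        closure K \<inter> closure L \<in> edges M \<or> hausdorff1 (closure K \<inter> closure L) = 0) \<and>
     (\<forall>K\<in>cells M. center M K \<in> K) \<and>
     inj_on (center M) (cells M) \<and>
     (\<forall>\<sigma> K L. is_interface M \<sigma> K L \<longrightarrow>
        (\<forall>p\<in>\<sigma>. \<forall>q\<in>\<sigma>. orthogonal (unit_normal M K L) (p - q)) \<and>
        affine hull {center M K, center M L} \<inter> \<sigma> = {edge_midpoint \<sigma>})"

definition interior_edges_of :: "mesh \<Rightarrow> plane set \<Rightarrow> plane set set" where
  "interior_edges_of M K = {\<sigma> \<in> cell_edges M K. \<exists>L. is_interface M \<sigma> K L}"

definition interior_edges :: "mesh \<Rightarrow> plane set set" where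
  "interior_edges M = (\<Union>K\<in>cells M. interior_edges_of M K)"

text \<open>On an admissible mesh an interior edge determines its two cells, hence \<open>neighbour\<close> is
  well-defined, and \<open>edge_cells\<close> is unique up to the order of its components; it is only used in
  expressions symmetric in the two cells.\<close>

definition neighbour :: "mesh \<Rightarrow> plane set \<Rightarrow> plane set \<Rightarrow> plane set" where
  "neighbour M K \<sigma> = (THE L. is_interface M \<sigma> K L)"

definition edge_cells :: "mesh \<Rightarrow> plane set \<Rightarrow> plane set \<times> plane set" where
  "edge_cells M \<sigma> = (SOME (K, L). is_interface M \<sigma> K L)"

definition edge_dist :: "mesh \<Rightarrow> plane set \<Rightarrow> real" where
  "edge_dist M \<sigma> = (case edge_cells M \<sigma> of (K, L) \<Rightarrow> dist (center M K) (center M L))"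

definition transmissivity :: "mesh \<Rightarrow> plane set \<Rightarrow> real" where
  "transmissivity M \<sigma> = edge_length \<sigma> / edge_dist M \<sigma>"

definition mesh_size :: "mesh \<Rightarrow> real" where
  "mesh_size M = (MAX K\<in>cells M. diameter K)"

definition regular_mesh :: "real \<Rightarrow> mesh \<Rightarrow> bool" where
  "regular_mesh \<zeta> M \<longleftrightarrow>
     (\<forall>K\<in>cells M. \<forall>\<sigma>\<in>interior_edges_of M K.
        dist (center M K) (edge_midpoint \<sigma>) \<ge> edge_dist M \<sigma> / \<zeta>) \<and>
     (\<forall>K\<in>cells M. area K \<ge> (diameter K)\<^sup>2 / \<zeta>)"


subsection \<open>The finite volume scheme\<close>

definition cell_mean :: "(plane \<Rightarrow> real) \<Rightarrow> plane set \<Rightarrow> real" where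
  "cell_mean f K = (LINT x:K|lebesgue. f x) / area K"

definition edge_conc :: "real \<Rightarrow> real \<Rightarrow> real" where
  "edge_conc a b = (if a = b \<and> a \<ge> 0 then a else if min a b \<le> 0 then 0
     else (a - b) / (ln a - ln b))"

definition theta_mesh :: "mesh \<Rightarrow> real \<Rightarrow> real \<Rightarrow> real" where
  "theta_mesh M \<rho> \<theta> = max \<theta> (\<rho> * mesh_size M)"

definition flux_sum :: "mesh \<Rightarrow> (plane set \<Rightarrow> real) \<Rightarrow> plane set \<Rightarrow> real" where
  "flux_sum M u K =
     (\<Sum>\<sigma>\<in>interior_edges_of M K. transmissivity M \<sigma> * (u K - u (neighbour M K \<sigma>)))"

text \<open>\<open>c n i K\<close> and \<open>\<mu> n i K\<close> are the values at time step \<open>n\<close> for species \<open>i \<in> {1,2}\<close> in cell \<open>K\<close>;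
  the values of \<open>\<mu> 0\<close> play no role.\<close>

definition scheme_solution ::
  "mesh \<Rightarrow> real \<Rightarrow> nat \<Rightarrow> real \<Rightarrow> real \<Rightarrow> real \<Rightarrow> (nat \<Rightarrow> real) \<Rightarrow> (nat \<Rightarrow> real) \<Rightarrow>
   (nat \<Rightarrow> plane \<Rightarrow> real) \<Rightarrow> (nat \<Rightarrow> plane \<Rightarrow> real) \<Rightarrow>
   (nat \<Rightarrow> nat \<Rightarrow> plane set \<Rightarrow> real) \<Rightarrow> (nat \<Rightarrow> nat \<Rightarrow> plane set \<Rightarrow> real) \<Rightarrow> bool" where
  "scheme_solution M T N \<alpha> \<kappa> \<rho> \<eta> \<theta> \<Psi> c0 c \<mu> \<longleftrightarrow>
     (\<forall>K\<in>cells M. \<forall>i\<in>{1,2}. c 0 i K = cell_mean (c0 i) K) \<and>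
     (\<forall>n\<in>{1..N}.
        (\<forall>K\<in>cells M. \<forall>i\<in>{1,2}.
           area K * ((c n i K - c (n - 1) i K) / (T / real N)) +
           (\<Sum>\<sigma>\<in>interior_edges_of M K. let L = neighbour M K \<sigma> in
              transmissivity M \<sigma> *
                (edge_conc (c n i K) (c n i L) / \<eta> i *
                   (\<mu> n i K + cell_mean (\<Psi> i) K - \<mu> n i L - cell_mean (\<Psi> i) L) +
                 theta_mesh M \<rho> (\<theta> i) * (c n i K - c n i L))) = 0) \<and>
        (\<forall>K\<in>cells M. \<mu> n 1 K - \<mu> n 2 K =
           \<alpha> / area K * flux_sum M (c n 1) K + \<kappa> * (1 - 2 * c (n - 1) 1 K)) \<and>
        (\<forall>K\<in>cells M. c n 1 K + c n 2 K = 1) \<and>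
        (\<Sum>K\<in>cells M. area K * (c n 1 K * \<mu> n 1 K + c n 2 K * \<mu> n 2 K)) = 0)"

end

theory Submission
  imports Defs
begin

text \<open>The estimate is an entropy estimate. With \<open>h(x) = x (ln x - 1)\<close>, whose derivative is \<open>ln\<close>, test
  the discrete mass balance of species \<open>i\<close> with \<open>\<eta>\<^sub>i ln c\<^sub>i\<close>. Each part of the
  balance then has a meaning:

  \<^item> By convexity of \<open>h\<close> the time difference controls the increase of the total entropy
    \<open>\<Sum>\<^sub>i \<eta>\<^sub>i \<Sum>\<^sub>K m\<^sub>K h(c\<^sub>i\<^sub>K)\<close> (\<open>entropy_convex\<close>).
  \<^item> The logarithmic mean on the edges is made for a discrete chain rule:
    \<open>c\<^sub>i\<^sub>\<sigma> (ln c\<^sub>i\<^sub>K - ln c\<^sub>i\<^sub>L) = c\<^sub>i\<^sub>K - c\<^sub>i\<^sub>L\<close>. Hence the convective flux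
    becomes linear in \<open>c\<^sub>i\<close>, and the diffusive one gives the Fisher information
    (\<open>log_tested_flux\<close>).
  \<^item> Since \<open>c\<^sub>1 + c\<^sub>2 = 1\<close>, the two convective terms add up to
    \<open>\<Sum>\<^sub>K F\<^sub>K (\<mu>\<^sub>1 + \<Psi>\<^sub>1 - \<mu>\<^sub>2 - \<Psi>\<^sub>2)\<^sub>K\<close>, where \<open>F\<^sub>K\<close> is the sum of the fluxes of
    \<open>c\<^sub>1\<close> out of \<open>K\<close> (\<open>species_coupling\<close>). The law for
    \<open>\<mu>\<^sub>1 - \<mu>\<^sub>2\<close> turns this into \<open>\<alpha> \<Sum>\<^sub>K m\<^sub>K (F\<^sub>K / m\<^sub>K)\<^sup>2\<close> plus terms linear in
    \<open>F\<^sub>K\<close>. The coefficients of these are bounded by \<open>\<kappa>\<close> and by the cell means of the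
    external potentials, so Young's inequality absorbs them (\<open>coupling_lower_bound\<close>).

  Summation over the time steps telescopes the entropy, which lies between two constants because
  \<open>0 \<le> c\<^sub>i \<le> 1\<close>. The bound on \<open>\<mu>\<^sub>1 - \<mu>\<^sub>2\<close> then follows from its law. All constants are
  built from \<open>\<eta>\<^sub>i\<close>, \<open>\<alpha>\<close>, \<open>\<kappa>\<close>, \<open>T\<close>, the area of \<open>\<Omega>\<close> and the \<open>L\<^sup>2\<close> norms of the
  \<open>\<Psi>\<^sub>i\<close>.

  Two ingredients need real work. First, discrete integration by parts
  (\<open>summation_by_parts\<close>) rests on the fact that an interior edge separates exactly two cells.
  Here the centres decide: both lie on one line through the midpoint of the edge, on opposite
  sides, and a third cell would have to overlap one of the two. Secondly, the logarithms need
  \<open>c\<^sub>i > 0\<close> (\<open>conc_pos_step\<close>), a discrete strong maximum principle: at a nonpositive minimum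
  the convective flux vanishes, the positive diffusion coefficient makes the neighbours minimal
  as well, and the minimum spreads over the whole mesh, which contradicts conservation of the
  positive mass. It spreads everywhere because \<open>\<Omega>\<close> stays connected after removal of the
  finitely many points where cells touch without sharing an edge (\<open>cells_connected\<close>).\<close>

section \<open>One-dimensional Hausdorff null sets in the plane\<close>

text \<open>A set of diameter \<open>d\<close> meets the line in parameters that lie in an interval of length at most
  \<open>2 d / l\<close> around any one of them, where \<open>l\<close> is the distance of \<open>p\<close> and \<open>q\<close>. Thus a cover of
  \<open>A\<close> with a small sum of diameters gives a cover of the parameter set with small total length.
  Closedness of \<open>A\<close> makes the parameter set measurable.\<close>

lemma hausdorff1_null_line:
  fixes A :: "plane set"
  assumes null: "hausdorff1 A = 0" and "closed A" and "p \<noteq> q"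
  shows "emeasure lborel {t::real. p + t *\<^sub>R (q - p) \<in> A} = 0"
proof -
  define S where "S = {t::real. p + t *\<^sub>R (q - p) \<in> A}"
  define l where "l = norm (q - p)"
  have l: "l > 0" using \<open>p \<noteq> q\<close> by (simp add: l_def)
  define cov where "cov = {U :: nat \<Rightarrow> plane set. A \<subseteq> (\<Union>j. U j) \<and>
      (\<forall>j. bounded (U j) \<and> diameter (U j) \<le> 1)}"
  have "(INF U\<in>cov. \<Sum>j. ennreal (diameter (U j))) \<le> hausdorff1 A"
    unfolding hausdorff1_def cov_def by (rule SUP_upper2[of 1]) auto
  then have inf0: "(INF U\<in>cov. \<Sum>j. ennreal (diameter (U j))) = 0"
    using null by simp
  have "emeasure lborel S * ennreal (l/2) \<le> (\<Sum>j. ennreal (diameter (U j)))" if "U \<in> cov" for U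
  proof -
    have U: "A \<subseteq> (\<Union>j. U j)" "\<And>j. bounded (U j)" using that by (auto simp: cov_def)
    define I where "I j = (if \<exists>t. p + t *\<^sub>R (q - p) \<in> U j then
      (let t = (SOME t. p + t *\<^sub>R (q - p) \<in> U j) in {t - diameter (U j) / l .. t + diameter (U j) / l})
      else {})" for j
    have sub: "S \<subseteq> (\<Union>j. I j)"
    proof
      fix s assume "s \<in> S"
      then obtain j where j: "p + s *\<^sub>R (q - p) \<in> U j" using U by (auto simp: S_def)
      define t where "t = (SOME t. p + t *\<^sub>R (q - p) \<in> U j)"
      have t: "p + t *\<^sub>R (q - p) \<in> U j" unfolding t_def using j by (rule someI)
      have "dist (p + s *\<^sub>R (q - p)) (p + t *\<^sub>R (q - p)) \<le> diameter (U j)"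
        by (rule diameter_bounded_bound[OF U(2) j t])
      moreover have "dist (p + s *\<^sub>R (q - p)) (p + t *\<^sub>R (q - p)) = \<bar>s - t\<bar> * l"
        by (simp add: dist_norm l_def flip: scaleR_left_diff_distrib)
      ultimately have "\<bar>s - t\<bar> \<le> diameter (U j) / l" using l by (simp add: field_simps)
      then have "s \<in> I j" using j by (auto simp: I_def Let_def t_def[symmetric])
      then show "s \<in> (\<Union>j. I j)" by blast
    qed
    have I_meas: "I j \<in> sets lborel" for j by (auto simp: I_def Let_def)
    have "emeasure lborel S \<le> emeasure lborel (\<Union>j. I j)"
      using sub I_meas by (intro emeasure_mono) auto
    also have "\<dots> \<le> (\<Sum>j. emeasure lborel (I j))"
      using I_meas by (intro emeasure_subadditive_countably) auto
    finally have "emeasure lborel S * ennreal (l/2) \<le> (\<Sum>j. emeasure lborel (I j)) * ennreal (l/2)"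
      by (intro mult_right_mono) auto
    also have "\<dots> = (\<Sum>j. emeasure lborel (I j) * ennreal (l/2))" by simp
    also have "\<dots> \<le> (\<Sum>j. ennreal (diameter (U j)))"
    proof (intro suminf_le allI)
      fix j
      have d: "0 \<le> diameter (U j)" by (rule diameter_ge_0[OF U(2)])
      have "emeasure lborel (I j) \<le> ennreal (2 * diameter (U j) / l)"
        using d l by (auto simp: I_def Let_def)
      then have "emeasure lborel (I j) * ennreal (l/2) \<le> ennreal (2 * diameter (U j) / l) * ennreal (l/2)"
        by (intro mult_right_mono) auto
      also have "\<dots> = ennreal (diameter (U j))" using l d by (simp flip: ennreal_mult)
      finally show "emeasure lborel (I j) * ennreal (l/2) \<le> ennreal (diameter (U j))" .
    qed auto
    finally show ?thesis .
  qed
  then have "emeasure lborel S * ennreal (l/2) \<le> (INF U\<in>cov. \<Sum>j. ennreal (diameter (U j)))"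
    by (intro INF_greatest)
  then have "emeasure lborel S * ennreal (l/2) = 0" by (simp add: inf0)
  then show ?thesis using l by (auto simp: S_def)
qed

text \<open>The null sets of this file are intersections of cell closures or of edges. This lemma is how
  their nullity is used: it makes convex ones points, and it shows that an edge cannot be composed
  of negligible pieces of other edges.\<close>

lemma hausdorff1_null_cover_segment:
  fixes F :: "plane set set"
  assumes "finite F" and null: "\<And>A. A \<in> F \<Longrightarrow> closed A \<and> hausdorff1 A = 0"
    and cover: "closed_segment p q \<subseteq> \<Union>F"
  shows "p = q"
proof (rule ccontr)
  assume "p \<noteq> q"
  define S where "S A = {t::real. p + t *\<^sub>R (q - p) \<in> A}" for A
  have "S A \<in> null_sets lborel" if "A \<in> F" for A
  proof -
    have "closed ((\<lambda>t. p + t *\<^sub>R (q - p)) -` A)"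
      using null[OF that] by (intro closed_vimage continuous_intros) auto
    then have "closed (S A)" by (simp add: S_def vimage_def)
    then show ?thesis
      using hausdorff1_null_line[of A p q] null[OF that] \<open>p \<noteq> q\<close>
      by (auto simp: null_sets_def S_def intro: borel_closed)
  qed
  then have "(\<Union>A\<in>F. S A) \<in> null_sets lborel"
    using \<open>finite F\<close> by (intro null_sets.finite_UN) auto
  moreover have "{0..1} \<subseteq> (\<Union>A\<in>F. S A)"
  proof
    fix t :: real assume "t \<in> {0..1}"
    then have "p + t *\<^sub>R (q - p) \<in> closed_segment p q"
      by (auto simp: in_segment algebra_simps intro!: exI[of _ t])
    then show "t \<in> (\<Union>A\<in>F. S A)" using cover by (auto simp: S_def)
  qed
  ultimately have "emeasure lborel {0..1::real} = 0"
    by (meson emeasure_eq_0 null_setsD1 null_setsD2)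
  then show False by simp
qed

lemma hausdorff1_null_convex:
  assumes "hausdorff1 A = 0" "closed A" "convex A" "p \<in> A" "q \<in> A"
  shows "p = q"
  using assms by (intro hausdorff1_null_cover_segment[of "{A}"])
    (auto simp: closed_segment_subset)

lemma hausdorff1_subsingleton:
  assumes "A \<subseteq> {p}" shows "hausdorff1 A = 0"
proof -
  have "(INF U\<in>{U :: nat \<Rightarrow> plane set. A \<subseteq> (\<Union>j. U j) \<and>
      (\<forall>j. bounded (U j) \<and> diameter (U j) \<le> \<delta>)}. \<Sum>j. ennreal (diameter (U j))) \<le> 0"
    if "\<delta> > 0" for \<delta>
    using assms that by (intro INF_lower2[of "\<lambda>_. {p}"]) auto
  then have "hausdorff1 A \<le> 0" unfolding hausdorff1_def by (intro SUP_least) auto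
  then show ?thesis by simp
qed

text \<open>A polygonal set has no slits. This places the cells, which are only known to lie in the
  closure of the domain, inside the domain itself.\<close>

lemma interior_closure_polygonal:
  assumes "polygonal S" shows "interior (closure S) \<subseteq> S"
proof -
  obtain P where P: "finite P" "\<forall>p\<in>P. polytope p" "S = interior (\<Union>P)"
    using assms by (auto simp: polygonal_def)
  have "closed (\<Union>P)" using P by (intro closed_Union) (auto intro: polytope_imp_closed)
  then have "closure S \<subseteq> \<Union>P" using P(3) by (simp add: closure_minimal interior_subset)
  then show ?thesis using P(3) interior_mono by blast
qed

section \<open>Interior edges of an admissible mesh\<close>

lemma is_interface_sym: "is_interface M \<sigma> K L \<longleftrightarrow> is_interface M \<sigma> L K"
  by (auto simp: is_interface_def)

locale mesh_on =
  fixes \<Omega> :: "plane set" and M :: mesh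
  assumes admissible: "admissible_mesh \<Omega> M"
    and open_domain: "open \<Omega>" and bounded_domain: "bounded \<Omega>"
    and connected_domain: "connected \<Omega>" and polygonal_domain: "polygonal \<Omega>"
begin

lemma finite_cells: "finite (cells M)" and finite_edges: "finite (edges M)"
  using admissible by (auto simp: admissible_mesh_def)

lemma cell:
  assumes "K \<in> cells M"
  shows "K \<noteq> {}" "open K" "convex K" "frontier K = \<Union>(cell_edges M K)"
    "cell_edges M K \<subseteq> edges M" "center M K \<in> K"
  using admissible assms by (auto simp: admissible_mesh_def)

lemma cells_disjoint: "K \<in> cells M \<Longrightarrow> L \<in> cells M \<Longrightarrow> K \<noteq> L \<Longrightarrow> K \<inter> L = {}"
  using admissible by (auto simp: admissible_mesh_def pairwise_def disjnt_def)

lemma cells_cover: "(\<Union>K\<in>cells M. closure K) = closure \<Omega>"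
  using admissible by (simp add: admissible_mesh_def)

lemma edge:
  assumes "\<sigma> \<in> edges M"
  shows "closed \<sigma>" "edge_length \<sigma> > 0" "hausdorff1 \<sigma> \<noteq> 0"
  using admissible assms by (auto simp: admissible_mesh_def edge_length_def)

lemma edges_overlap_null:
  "\<sigma> \<in> edges M \<Longrightarrow> \<sigma>' \<in> edges M \<Longrightarrow> \<sigma> \<noteq> \<sigma>' \<Longrightarrow> hausdorff1 (\<sigma> \<inter> \<sigma>') = 0"
  using admissible by (auto simp: admissible_mesh_def)

lemma cell_closures_meet:
  "K \<in> cells M \<Longrightarrow> L \<in> cells M \<Longrightarrow> K \<noteq> L \<Longrightarrow>
    closure K \<inter> closure L \<in> edges M \<or> hausdorff1 (closure K \<inter> closure L) = 0"
  using admissible by (auto simp: admissible_mesh_def)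

lemma cell_subset_domain: "K \<in> cells M \<Longrightarrow> K \<subseteq> \<Omega>"
proof -
  assume K: "K \<in> cells M"
  have "K \<subseteq> closure \<Omega>" using cells_cover K closure_subset by blast
  then have "K \<subseteq> interior (closure \<Omega>)" using cell(2)[OF K] by (simp add: interior_maximal)
  then show ?thesis using interior_closure_polygonal[OF polygonal_domain] by blast
qed

lemma cell_bounded: "K \<in> cells M \<Longrightarrow> bounded K"
  using cell_subset_domain bounded_domain bounded_subset by blast

lemma cell_disjoint_closure:
  assumes "K \<in> cells M" "L \<in> cells M" "K \<noteq> L"
  shows "K \<inter> closure L = {}"
  using cells_disjoint[OF assms] open_Int_closure_eq_empty[OF cell(2)[OF assms(1)]] by blast

lemma edge_midpoint_on_centre_line:
  assumes "is_interface M \<sigma> K L"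
  shows "edge_midpoint \<sigma> \<in> \<sigma>" "edge_midpoint \<sigma> \<in> affine hull {center M K, center M L}"
proof -
  have "affine hull {center M K, center M L} \<inter> \<sigma> = {edge_midpoint \<sigma>}"
    using admissible assms unfolding admissible_mesh_def by blast
  then show "edge_midpoint \<sigma> \<in> \<sigma>" "edge_midpoint \<sigma> \<in> affine hull {center M K, center M L}" by blast+
qed

lemma centre_ray_in_cell:
  assumes "K \<in> cells M" "m \<in> closure K" "m \<noteq> center M K" "0 < t" "t \<le> 1"
  shows "m + t *\<^sub>R (center M K - m) \<in> K"
proof (cases "t = 1")
  case True then show ?thesis using cell(6)[OF assms(1)] by simp
next
  case False
  have "m + t *\<^sub>R (center M K - m) \<in> open_segment (center M K) m"
    using assms False
    by (auto simp: in_segment algebra_simps intro!: exI[of _ "1 - t"])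
  moreover have "open_segment (center M K) m \<subseteq> interior K"
    using cell[OF assms(1)] assms(2)
    by (intro in_interior_closure_convex_segment) (auto simp: interior_open)
  ultimately show ?thesis using interior_subset by blast
qed

text \<open>The midpoint of \<open>K|L\<close> lies on the line of the centres. The half-open segments from the midpoint
  to the centres run inside the respective cells, so if they pointed in the same direction the
  two cells would overlap.\<close>

lemma centres_opposite:
  assumes "is_interface M \<sigma> K L"
  obtains s where "s > 0" "center M L - edge_midpoint \<sigma> = - s *\<^sub>R (center M K - edge_midpoint \<sigma>)"
    "center M K \<noteq> edge_midpoint \<sigma>" "center M L \<noteq> edge_midpoint \<sigma>"
proof -
  define m where "m = edge_midpoint \<sigma>"
  have KL: "K \<in> cells M" "L \<in> cells M" "K \<noteq> L" "\<sigma> = closure K \<inter> closure L"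
    using assms by (auto simp: is_interface_def)
  have m: "m \<in> closure K" "m \<in> closure L" "m \<in> affine hull {center M K, center M L}"
    using edge_midpoint_on_centre_line[OF assms] KL by (auto simp: m_def)
  have neK: "center M K \<noteq> m" using cell_disjoint_closure[OF KL(1-3)] cell(6)[OF KL(1)] m by auto
  have neL: "center M L \<noteq> m"
    using cell_disjoint_closure[OF KL(2,1)] KL(3) cell(6)[OF KL(2)] m by auto
  obtain u v where uv: "m = u *\<^sub>R center M K + v *\<^sub>R center M L" "u + v = 1"
    using m(3) by (auto simp: affine_hull_2)
  have "u *\<^sub>R (center M K - m) + v *\<^sub>R (center M L - m) =
      (u *\<^sub>R center M K + v *\<^sub>R center M L) - (u + v) *\<^sub>R m"
    by (simp add: algebra_simps)
  also have "\<dots> = 0" unfolding uv(2) by (simp flip: uv(1))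
  finally have zero: "u *\<^sub>R (center M K - m) + v *\<^sub>R (center M L - m) = 0" .
  have v: "v \<noteq> 0" using zero neK uv(2) by auto
  define s where "s = u / v"
  have "v *\<^sub>R (center M L - m) = v *\<^sub>R (- s *\<^sub>R (center M K - m))"
    using zero v by (simp add: s_def eq_neg_iff_add_eq_0 add.commute)
  then have eq: "center M L - m = - s *\<^sub>R (center M K - m)" using v by (metis scaleR_cancel_left)
  have "s > 0"
  proof (rule ccontr)
    assume "\<not> s > 0"
    moreover have "s \<noteq> 0" using eq neL by auto
    ultimately have s: "s < 0" by simp
    \<comment> \<open>The parameter \<open>t\<close> on the ray to \<open>L\<close> is \<open>- s t\<close> on the ray to \<open>K\<close>; both must be at most 1.\<close>
    define t where "t = min 1 (1 / (- s))"
    have t: "0 < t" "t \<le> 1" "0 < t * (-s)" "t * (-s) \<le> 1"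
      using s by (auto simp: t_def min_def field_simps)
    have "m + (t * (-s)) *\<^sub>R (center M K - m) \<in> K"
      using neK t(3,4) by (intro centre_ray_in_cell[OF KL(1) m(1)]) auto
    moreover have "m + t *\<^sub>R (center M L - m) \<in> L"
      using neL t(1,2) by (intro centre_ray_in_cell[OF KL(2) m(2)]) auto
    ultimately show False using cells_disjoint[OF KL(1-3)] by (auto simp: eq)
  qed
  then show ?thesis using that eq neK neL by (simp add: m_def)
qed

text \<open>The centres of \<open>L\<close> and \<open>L'\<close> both lie on the ray from the midpoint of \<open>\<sigma>\<close> that points away
  from the centre of \<open>K\<close>. Near the midpoint this ray runs in both cells.\<close>

lemma interface_unique:
  assumes "is_interface M \<sigma> K L" "is_interface M \<sigma> K L'"
  shows "L = L'"
proof (rule ccontr)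
  assume ne: "L \<noteq> L'"
  define m where "m = edge_midpoint \<sigma>"
  have cs: "L \<in> cells M" "L' \<in> cells M" "m \<in> closure L" "m \<in> closure L'"
    using assms edge_midpoint_on_centre_line(1) by (auto simp: is_interface_def m_def)
  obtain s where s: "s > 0" "center M L - m = - s *\<^sub>R (center M K - m)" "center M L \<noteq> m"
    using centres_opposite[OF assms(1)] unfolding m_def by metis
  obtain s' where s': "s' > 0" "center M L' - m = - s' *\<^sub>R (center M K - m)" "center M L' \<noteq> m"
    using centres_opposite[OF assms(2)] unfolding m_def by metis
  \<comment> \<open>In units of the vector from the midpoint to the centre of \<open>K\<close>, the point at \<open>- r\<close>
      comes no later than the centres of \<open>L\<close> and \<open>L'\<close>.\<close>
  define r where "r = min s s'"
  have r: "0 < r / s" "r / s \<le> 1" "0 < r / s'" "r / s' \<le> 1"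
    using s s' by (auto simp: r_def min_def field_simps)
  have "m + (r / s) *\<^sub>R (center M L - m) \<in> L" "m + (r / s') *\<^sub>R (center M L' - m) \<in> L'"
    using centre_ray_in_cell cs r s(3) s'(3) by auto
  then have "m - r *\<^sub>R (center M K - m) \<in> L \<inter> L'" using s s' by auto
  then show False using cells_disjoint[OF cs(1,2) ne] by auto
qed

text \<open>If a third cell \<open>K'\<close> had \<open>\<sigma>\<close> in its closure, then \<open>K\<close> and \<open>K'\<close> would meet in a set that contains
  \<open>\<sigma>\<close> and is therefore an edge itself. Distinct edges overlap in null sets, so this edge is
  \<open>\<sigma>\<close>, and the previous lemma applies with \<open>K\<close> as the common cell.\<close>

lemma interface_endpoints:
  assumes "is_interface M \<sigma> K L" "is_interface M \<sigma> K' L'"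
  shows "K' = K \<and> L' = L \<or> K' = L \<and> L' = K"
proof -
  have "K' = L" if "K' \<noteq> K"
  proof -
    have i: "K \<in> cells M" "K' \<in> cells M" "\<sigma> \<subseteq> closure K \<inter> closure K'" "\<sigma> \<in> edges M"
      using assms by (auto simp: is_interface_def)
    let ?s = "closure K \<inter> closure K'"
    have "hausdorff1 ?s = 0 \<Longrightarrow> \<exists>p. \<sigma> \<subseteq> {p}"
    proof -
      assume "hausdorff1 ?s = 0"
      then have "\<And>p q. p \<in> ?s \<Longrightarrow> q \<in> ?s \<Longrightarrow> p = q"
        using cell(3)[OF i(1)] cell(3)[OF i(2)]
        by (intro hausdorff1_null_convex[of ?s]) (auto intro!: convex_Int convex_closure)
      then show ?thesis using i(3) by blast
    qed
    then have "?s \<in> edges M"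
      using cell_closures_meet[OF i(1,2)] that edge(3)[OF i(4)] hausdorff1_subsingleton by blast
    moreover have "\<sigma> \<inter> ?s = \<sigma>" using i(3) by blast
    ultimately have "\<sigma> = ?s" using edges_overlap_null[of \<sigma> ?s] edge(3) i(4) by metis
    then have "is_interface M \<sigma> K K'" using i that by (auto simp: is_interface_def)
    then show ?thesis using interface_unique assms(1) by blast
  qed
  then show ?thesis using assms interface_unique is_interface_sym by metis
qed

lemma neighbour_eq:
  assumes "is_interface M \<sigma> K L"
  shows "neighbour M K \<sigma> = L"
  unfolding neighbour_def using assms
  by (rule the_equality) (rule interface_unique[OF _ assms])

lemma edge_cells_interface:
  assumes "is_interface M \<sigma> K L"
  shows "case edge_cells M \<sigma> of (K, L) \<Rightarrow> is_interface M \<sigma> K L"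
  unfolding edge_cells_def using assms by (intro someI_ex[of "\<lambda>p. case p of (K, L) \<Rightarrow> is_interface M \<sigma> K L"]) auto

text \<open>The edge \<open>\<sigma>\<close> lies in the boundary of \<open>K\<close>, which the edges of \<open>K\<close> cover. If \<open>\<sigma>\<close> were none of
  them, they would cover it by finitely many null sets.\<close>

lemma interface_in_cell_edges:
  assumes "is_interface M \<sigma> K L"
  shows "\<sigma> \<in> cell_edges M K"
proof (rule ccontr)
  assume nin: "\<sigma> \<notin> cell_edges M K"
  have i: "K \<in> cells M" "L \<in> cells M" "K \<noteq> L" "\<sigma> \<in> edges M" "\<sigma> = closure K \<inter> closure L"
    using assms by (auto simp: is_interface_def)
  have "\<sigma> \<subseteq> frontier K"
    using cell_disjoint_closure[OF i(1-3)] i(5) cell(2)[OF i(1)]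
    by (auto simp: frontier_def interior_open)
  then have cover: "\<sigma> \<subseteq> (\<Union>\<sigma>'\<in>cell_edges M K. \<sigma> \<inter> \<sigma>')" using cell(4)[OF i(1)] by auto
  have conv: "convex \<sigma>" using i cell(3) by (auto intro!: convex_Int convex_closure)
  have "p = q" if "p \<in> \<sigma>" "q \<in> \<sigma>" for p q
  proof (rule hausdorff1_null_cover_segment)
    show "finite ((\<lambda>\<sigma>'. \<sigma> \<inter> \<sigma>') ` cell_edges M K)"
      using finite_edges cell(5)[OF i(1)] finite_subset by blast
    show "closed A \<and> hausdorff1 A = 0" if "A \<in> (\<lambda>\<sigma>'. \<sigma> \<inter> \<sigma>') ` cell_edges M K" for A
      using that edges_overlap_null[OF i(4)] cell(5)[OF i(1)] edge(1) i(4) nin by auto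
    show "closed_segment p q \<subseteq> \<Union>((\<lambda>\<sigma>'. \<sigma> \<inter> \<sigma>') ` cell_edges M K)"
      using closed_segment_subset[OF that conv] cover by blast
  qed
  then have "\<exists>p. \<sigma> \<subseteq> {p}" by blast
  then show False using hausdorff1_subsingleton edge(3)[OF i(4)] by blast
qed

lemma interior_edges_of_iff: "\<sigma> \<in> interior_edges_of M K \<longleftrightarrow> (\<exists>L. is_interface M \<sigma> K L)"
  using interface_in_cell_edges by (auto simp: interior_edges_of_def)

lemma interior_edges_iff: "\<sigma> \<in> interior_edges M \<longleftrightarrow> (\<exists>K L. is_interface M \<sigma> K L)"
  by (auto simp: interior_edges_def interior_edges_of_iff) (auto simp: is_interface_def)

lemma finite_interior_edges: "finite (interior_edges M)" "finite (interior_edges_of M K)"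
  by (rule finite_subset[OF _ finite_edges],
      auto simp: interior_edges_iff interior_edges_of_iff is_interface_def)+

lemma transmissivity_pos:
  assumes "\<sigma> \<in> interior_edges M"
  shows "transmissivity M \<sigma> > 0"
proof -
  obtain K L where i: "is_interface M \<sigma> K L" using assms interior_edges_iff by blast
  obtain K' L' where e: "edge_cells M \<sigma> = (K', L')" by force
  have i': "is_interface M \<sigma> K' L'" using edge_cells_interface[OF i] e by simp
  have "inj_on (center M) (cells M)" using admissible by (simp add: admissible_mesh_def)
  then have "center M K' \<noteq> center M L'" using i' unfolding is_interface_def inj_on_def by blast
  moreover have "edge_length \<sigma> > 0" using edge(2) i' unfolding is_interface_def by blast
  ultimately show ?thesis by (simp add: transmissivity_def edge_dist_def e)
qed

definition edge_sum :: "(plane set \<Rightarrow> plane set \<Rightarrow> plane set \<Rightarrow> real) \<Rightarrow> real" where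
  "edge_sum g = (\<Sum>\<sigma>\<in>interior_edges M. case edge_cells M \<sigma> of (K, L) \<Rightarrow> g \<sigma> K L)"

text \<open>Discrete integration by parts: an interior edge occurs in the double sum exactly for its two
  cells, with opposite signs.\<close>

lemma summation_by_parts:
  fixes G :: "plane set \<Rightarrow> plane set \<Rightarrow> plane set \<Rightarrow> real"
  assumes anti: "\<And>\<sigma> K L. is_interface M \<sigma> K L \<Longrightarrow> G \<sigma> L K = - G \<sigma> K L"
  shows "(\<Sum>K\<in>cells M. (\<Sum>\<sigma>\<in>interior_edges_of M K. G \<sigma> K (neighbour M K \<sigma>)) * \<phi> K) =
    edge_sum (\<lambda>\<sigma> K L. G \<sigma> K L * (\<phi> K - \<phi> L))"
proof -
  let ?g = "\<lambda>K \<sigma>. G \<sigma> K (neighbour M K \<sigma>) * \<phi> K"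
  have "(\<Sum>K\<in>cells M. (\<Sum>\<sigma>\<in>interior_edges_of M K. G \<sigma> K (neighbour M K \<sigma>)) * \<phi> K) =
    (\<Sum>K\<in>cells M. \<Sum>\<sigma>\<in>{\<sigma>\<in>interior_edges M. \<sigma> \<in> interior_edges_of M K}. ?g K \<sigma>)"
    by (intro sum.cong refl)
      (auto simp: sum_distrib_right interior_edges_def intro!: sum.cong)
  also have "\<dots> = (\<Sum>\<sigma>\<in>interior_edges M. \<Sum>K\<in>{K\<in>cells M. \<sigma> \<in> interior_edges_of M K}. ?g K \<sigma>)"
    by (intro sum.swap_restrict finite_cells finite_interior_edges)
  also have "\<dots> = (\<Sum>\<sigma>\<in>interior_edges M. case edge_cells M \<sigma> of (K, L) \<Rightarrow> G \<sigma> K L * (\<phi> K - \<phi> L))"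
  proof (intro sum.cong refl)
    fix \<sigma> assume "\<sigma> \<in> interior_edges M"
    then obtain K0 L0 where i0: "is_interface M \<sigma> K0 L0" using interior_edges_iff by blast
    obtain K L where e: "edge_cells M \<sigma> = (K, L)" by force
    have i: "is_interface M \<sigma> K L" using edge_cells_interface[OF i0] e by simp
    then have i': "is_interface M \<sigma> L K" by (simp add: is_interface_sym)
    have KL: "K \<in> cells M" "L \<in> cells M" "K \<noteq> L" using i by (auto simp: is_interface_def)
    have "{K\<in>cells M. \<sigma> \<in> interior_edges_of M K} = {K, L}"
      using i i' interface_endpoints[OF i] KL by (auto simp: interior_edges_of_iff)
    then show "(\<Sum>K\<in>{K\<in>cells M. \<sigma> \<in> interior_edges_of M K}. ?g K \<sigma>) =
        (case edge_cells M \<sigma> of (K, L) \<Rightarrow> G \<sigma> K L * (\<phi> K - \<phi> L))"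
      using KL anti[OF i] neighbour_eq[OF i] neighbour_eq[OF i'] by (simp add: e algebra_simps)
  qed
  finally show ?thesis unfolding edge_sum_def .
qed

text \<open>Between the cells of \<open>A\<close> and the others there are only contacts in null sets, which are convex
  and hence at most points. The domain without these finitely many points is still connected, but
  the closures of the cells in \<open>A\<close> and of the other cells would separate it.\<close>

lemma cells_connected:
  assumes "A \<subseteq> cells M" "A \<noteq> {}"
    and step: "\<And>\<sigma> K L. is_interface M \<sigma> K L \<Longrightarrow> K \<in> A \<Longrightarrow> L \<in> A"
  shows "A = cells M"
proof (rule ccontr)
  assume "A \<noteq> cells M"
  define B where "B = cells M - A"
  have B: "B \<noteq> {}" "B \<subseteq> cells M" using assms(1) \<open>A \<noteq> cells M\<close> by (auto simp: B_def)
  have fin: "finite A" "finite B" using finite_cells assms(1) B finite_subset by auto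
  define S where "S = (\<Union>K\<in>A. \<Union>L\<in>B. closure K \<inter> closure L)"
  have "finite (closure K \<inter> closure L)" if "K \<in> A" "L \<in> B" for K L
  proof -
    have KL: "K \<in> cells M" "L \<in> cells M" "K \<noteq> L" using that assms(1) by (auto simp: B_def)
    have "\<not> is_interface M (closure K \<inter> closure L) K L" using step that by (auto simp: B_def)
    then have "closure K \<inter> closure L \<notin> edges M" using KL by (auto simp: is_interface_def)
    then have "hausdorff1 (closure K \<inter> closure L) = 0" using cell_closures_meet[OF KL] by blast
    then have "p = q" if "p \<in> closure K \<inter> closure L" "q \<in> closure K \<inter> closure L" for p q
      using that cell(3)[OF KL(1)] cell(3)[OF KL(2)]
      by (intro hausdorff1_null_convex[of "closure K \<inter> closure L"])
        (auto intro!: convex_Int convex_closure)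
    then have "\<exists>p. closure K \<inter> closure L \<subseteq> {p}" by blast
    then show ?thesis using finite_subset by blast
  qed
  then have S: "finite S" unfolding S_def using fin by (intro finite_UN_I)
  have conn: "connected (\<Omega> - S)"
    using connected_open_delete_finite[OF open_domain connected_domain _ S] by simp
  define UA where "UA = (\<Union>K\<in>A. closure K)"
  define UB where "UB = (\<Union>K\<in>B. closure K)"
  have "closed UA" "closed UB" using fin by (auto simp: UA_def UB_def)
  moreover have "\<Omega> - S \<subseteq> UA \<union> UB"
  proof -
    have "\<Omega> \<subseteq> (\<Union>K\<in>cells M. closure K)" using cells_cover closure_subset[of \<Omega>] by blast
    then show ?thesis by (auto simp: UA_def UB_def B_def)
  qed
  moreover have "UA \<inter> UB \<inter> (\<Omega> - S) = {}" by (auto simp: UA_def UB_def S_def)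
  ultimately have disj: "UA \<inter> (\<Omega> - S) = {} \<or> UB \<inter> (\<Omega> - S) = {}"
    using conn unfolding connected_closed by blast
  have hit: "\<exists>x. x \<in> K \<and> x \<in> \<Omega> - S" if "K \<in> cells M" for K
  proof -
    have "infinite K" using cell(1,2)[OF that] finite_imp_not_open by blast
    then have "\<not> K \<subseteq> S" using S finite_subset by blast
    then show ?thesis using cell_subset_domain[OF that] by blast
  qed
  obtain K L where KL: "K \<in> A" "L \<in> B" using assms(2) B by blast
  obtain x where "x \<in> K" "x \<in> \<Omega> - S" using hit[of K] KL assms(1) by auto
  then have "x \<in> UA \<inter> (\<Omega> - S)" using KL closure_subset[of K] by (auto simp: UA_def)
  moreover obtain y where "y \<in> L" "y \<in> \<Omega> - S" using hit[of L] KL B by auto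
  then have "y \<in> UB \<inter> (\<Omega> - S)" using KL closure_subset[of L] by (auto simp: UB_def)
  ultimately show False using disj by blast
qed

end

section \<open>Cell averages of square integrable functions\<close>

lemma L2_subset:
  assumes "L2 \<Omega> f" "K \<in> sets lebesgue" "K \<subseteq> \<Omega>"
  shows "L2 K f"
  using assms unfolding L2_def
  by (blast intro: set_integrable_subset set_borel_measurable_subset)

lemma set_integrable_const:
  assumes "K \<in> lmeasurable" shows "set_integrable lebesgue K (\<lambda>_. c :: real)"
  using assms by (simp add: set_integrable_def lmeasurable_iff_integrable)

lemma set_integral_const_lmeasurable:
  assumes "K \<in> lmeasurable"
  shows "(LINT x:K|lebesgue. c :: real) = area K * c"
proof -
  have "emeasure lebesgue K \<noteq> \<infinity>" using fmeasurableD2[OF assms] by (metis infinity_ennreal_def)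
  from set_integral_const[OF fmeasurableD[OF assms] this, of c] show ?thesis
    by (simp only: real_scaleR_def)
qed

lemma L2_integrable:
  assumes f: "L2 K f" and K: "K \<in> lmeasurable"
  shows "set_integrable lebesgue K f"
proof (rule set_integrable_bound)
  show "set_integrable lebesgue K (\<lambda>x. 1 + (f x)\<^sup>2)"
    using f by (intro set_integral_add set_integrable_const K) (auto simp: L2_def)
  show "set_borel_measurable lebesgue K f" using f by (simp add: L2_def)
  have "\<bar>y\<bar> \<le> 1 + y\<^sup>2" for y :: real
  proof -
    have "0 \<le> (\<bar>y\<bar> - 1)\<^sup>2" by simp
    then show ?thesis by (simp add: power2_eq_square algebra_simps abs_mult_self_eq)
  qed
  then show "AE x in lebesgue. x \<in> K \<longrightarrow> norm (f x) \<le> norm (1 + (f x)\<^sup>2)"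
    by (auto intro!: AE_I2)
qed

text \<open>Jensen's inequality for the square, obtained by expanding the nonnegative integral of
  \<open>(f - m)\<^sup>2\<close> with \<open>m\<close> the mean of \<open>f\<close>.\<close>

lemma cell_mean_square_le:
  assumes f: "L2 K f" and K: "K \<in> lmeasurable" and pos: "area K > 0"
  shows "area K * (cell_mean f K)\<^sup>2 \<le> (LINT x:K|lebesgue. (f x)\<^sup>2)"
proof -
  define m where "m = cell_mean f K"
  have int: "set_integrable lebesgue K f" "set_integrable lebesgue K (\<lambda>x. (f x)\<^sup>2)"
    using L2_integrable[OF f K] f by (auto simp: L2_def)
  have c: "(LINT x:K|lebesgue. m\<^sup>2) = area K * m\<^sup>2"
    by (rule set_integral_const_lmeasurable[OF K])
  have "0 \<le> (LINT x:K|lebesgue. (f x - m)\<^sup>2)"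
    unfolding set_lebesgue_integral_def by (intro Bochner_Integration.integral_nonneg) (simp add: indicator_def)
  also have "(\<lambda>x. (f x - m)\<^sup>2) = (\<lambda>x. ((f x)\<^sup>2 - (2 * m) * f x) + m\<^sup>2)"
    by (auto simp: power2_eq_square algebra_simps)
  also have "(LINT x:K|lebesgue. ((f x)\<^sup>2 - (2 * m) * f x) + m\<^sup>2) =
      (LINT x:K|lebesgue. (f x)\<^sup>2) - 2 * m * (LINT x:K|lebesgue. f x) + area K * m\<^sup>2"
    using int set_integrable_const[OF K, of "m\<^sup>2"] by (simp add: c set_integral_add set_integral_diff)
  also have "(LINT x:K|lebesgue. f x) = area K * m" using pos by (simp add: m_def cell_mean_def)
  finally show ?thesis by (simp add: m_def[symmetric] power2_eq_square algebra_simps)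
qed

context mesh_on
begin

lemma domain_lmeasurable: "\<Omega> \<in> lmeasurable"
  using open_domain bounded_domain by (rule lmeasurable_open[rotated])

lemma cell_lmeasurable: "K \<in> cells M \<Longrightarrow> K \<in> lmeasurable"
  using cell(2) cell_bounded by (metis lmeasurable_open)

lemma cell_area_pos:
  assumes "K \<in> cells M" shows "area K > 0"
proof -
  have "\<not> negligible K" using cell(1,2)[OF assms] open_not_negligible by blast
  then show ?thesis
    using negligible_iff_measure0[OF cell_lmeasurable[OF assms]] by (simp add: zero_less_measure_iff)
qed

text \<open>Only boundaries of cells are left out, and boundaries of convex sets are Lebesgue null.\<close>

lemma cells_cover_AE: "AE x in lebesgue. x \<in> \<Omega> \<longleftrightarrow> x \<in> \<Union>(cells M)"
proof -
  have "negligible (\<Union>K\<in>cells M. frontier K)"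
    using finite_cells cell(3) by (intro negligible_Union) (auto intro: negligible_convex_frontier)
  then have "(\<Union>K\<in>cells M. frontier K) \<in> null_sets lebesgue"
    by (simp add: negligible_iff_null_sets)
  then have "AE x in lebesgue. x \<notin> (\<Union>K\<in>cells M. frontier K)" by (rule AE_not_in)
  then show ?thesis
  proof eventually_elim
    case (elim x)
    have "\<Omega> \<subseteq> (\<Union>K\<in>cells M. closure K)" using cells_cover closure_subset[of \<Omega>] by blast
    then show ?case
      using elim cell_subset_domain cell(2) by (fastforce simp: frontier_def interior_open)
  qed
qed

lemma sum_integral_cells:
  fixes f :: "plane \<Rightarrow> real"
  assumes int: "set_integrable lebesgue \<Omega> f"
  shows "(\<Sum>K\<in>cells M. LINT x:K|lebesgue. f x) = (LINT x:\<Omega>|lebesgue. f x)"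
proof -
  have m: "K \<in> sets lebesgue" if "K \<in> cells M" for K
    using cell_lmeasurable[OF that] by (rule fmeasurableD)
  have mU: "(\<Union>K\<in>cells M. K) \<in> sets lebesgue" using m finite_cells by (intro sets.finite_UN) auto
  have sub: "(\<Union>K\<in>cells M. K) \<subseteq> \<Omega>" using cell_subset_domain by blast
  have "(\<Sum>K\<in>cells M. LINT x:K|lebesgue. f x) = (LINT x:(\<Union>K\<in>cells M. K)|lebesgue. f x)"
    using m cell_subset_domain cells_disjoint finite_cells
    by (intro set_integral_finite_Union[symmetric] set_integrable_subset[OF int])
      (auto simp: disjoint_family_on_def)
  also have "\<dots> = (LINT x:\<Omega>|lebesgue. f x)"
    using int set_integrable_subset[OF int mU sub] cells_cover_AE
    by (intro set_integral_cong_set)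
      (auto simp: set_integrable_def set_borel_measurable_def)
  finally show ?thesis .
qed

lemma sum_area: "(\<Sum>K\<in>cells M. area K) = area \<Omega>"
  using sum_integral_cells[OF set_integrable_const[OF domain_lmeasurable, of 1]]
    cell_lmeasurable domain_lmeasurable by (simp add: set_integral_const_lmeasurable)

lemma sum_cell_mean_square_le:
  assumes "L2 \<Omega> f"
  shows "(\<Sum>K\<in>cells M. area K * (cell_mean f K)\<^sup>2) \<le> (LINT x:\<Omega>|lebesgue. (f x)\<^sup>2)"
proof -
  have "(\<Sum>K\<in>cells M. area K * (cell_mean f K)\<^sup>2) \<le> (\<Sum>K\<in>cells M. LINT x:K|lebesgue. (f x)\<^sup>2)"
    by (intro sum_mono cell_mean_square_le L2_subset[OF assms] fmeasurableD cell_lmeasurable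
        cell_area_pos cell_subset_domain)
  also have "\<dots> = (LINT x:\<Omega>|lebesgue. (f x)\<^sup>2)"
    using assms by (intro sum_integral_cells) (simp add: L2_def)
  finally show ?thesis .
qed

lemma mesh_size_pos:
  assumes "cells M \<noteq> {}" shows "mesh_size M > 0"
proof -
  obtain K where K: "K \<in> cells M" using assms by blast
  have "infinite K" using cell(1,2)[OF K] finite_imp_not_open by blast
  then have "\<not> K \<subseteq> {p}" for p using finite_subset by blast
  then obtain p q where "p \<in> K" "q \<in> K" "p \<noteq> q" by blast
  then have "0 < dist p q" "dist p q \<le> diameter K"
    using diameter_bounded_bound[OF cell_bounded[OF K]] by auto
  moreover have "diameter K \<le> mesh_size M"
    unfolding mesh_size_def using K finite_cells by (intro Max_ge) auto
  ultimately show ?thesis by linarith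
qed

section \<open>Sums over interior edges\<close>

lemma edge_sum_cong:
  assumes "\<And>\<sigma> K L. K \<in> cells M \<Longrightarrow> L \<in> cells M \<Longrightarrow> g \<sigma> K L = g' \<sigma> K L"
  shows "edge_sum g = edge_sum g'"
  unfolding edge_sum_def
proof (rule sum.cong[OF refl])
  fix \<sigma> assume "\<sigma> \<in> interior_edges M"
  then obtain K L where "is_interface M \<sigma> K L" using interior_edges_iff by blast
  from edge_cells_interface[OF this]
  show "(case edge_cells M \<sigma> of (K, L) \<Rightarrow> g \<sigma> K L) = (case edge_cells M \<sigma> of (K, L) \<Rightarrow> g' \<sigma> K L)"
    using assms by (auto simp: is_interface_def split: prod.splits)
qed

lemma edge_sum_nonneg:
  assumes "\<And>\<sigma> K L. \<sigma> \<in> interior_edges M \<Longrightarrow> K \<in> cells M \<Longrightarrow> L \<in> cells M \<Longrightarrow> 0 \<le> g \<sigma> K L"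
  shows "0 \<le> edge_sum g"
  unfolding edge_sum_def
proof (rule sum_nonneg)
  fix \<sigma> assume \<sigma>: "\<sigma> \<in> interior_edges M"
  then obtain K L where "is_interface M \<sigma> K L" using interior_edges_iff by blast
  from edge_cells_interface[OF this]
  show "0 \<le> (case edge_cells M \<sigma> of (K, L) \<Rightarrow> g \<sigma> K L)"
    using assms[OF \<sigma>] by (auto simp: is_interface_def split: prod.splits)
qed

lemma edge_sum_add: "edge_sum (\<lambda>\<sigma> K L. g \<sigma> K L + g' \<sigma> K L) = edge_sum g + edge_sum g'"
  by (simp add: edge_sum_def split_def sum.distrib)

lemma edge_sum_cmult: "edge_sum (\<lambda>\<sigma> K L. a * g \<sigma> K L) = a * edge_sum g"
  by (simp add: edge_sum_def split_def sum_distrib_left)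

lemma flux_sum_by_parts:
  "(\<Sum>K\<in>cells M. flux_sum M u K * w K) =
    edge_sum (\<lambda>\<sigma> K L. transmissivity M \<sigma> * (u K - u L) * (w K - w L))"
  unfolding flux_sum_def
  by (rule summation_by_parts[where G="\<lambda>\<sigma> K L. transmissivity M \<sigma> * (u K - u L)"]) (simp add: algebra_simps)

end

section \<open>Logarithmic mean and entropy\<close>

lemma edge_conc_commute: "edge_conc a b = edge_conc b a"
proof -
  have "(a - b) / (ln a - ln b) = (b - a) / (ln b - ln a)"
    by (metis minus_diff_eq minus_divide_divide)
  then show ?thesis by (auto simp: edge_conc_def min.commute)
qed

text \<open>The discrete form of the chain rule \<open>c \<nabla>(ln c) = \<nabla>c\<close>.\<close>

lemma edge_conc_log_difference:
  assumes "a > 0" "b > 0" shows "edge_conc a b * (ln a - ln b) = a - b"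
  using assms by (auto simp: edge_conc_def min_def)

lemma edge_conc_at_nonpos_min:
  assumes "a \<le> 0" "a \<le> b" shows "edge_conc a b = 0"
  using assms by (auto simp: edge_conc_def min_def)

text \<open>The primitive of \<open>ln\<close> that vanishes at 0. At 0 the factor \<open>x\<close> gives the limit
  value 0, whatever \<open>ln 0\<close> is.\<close>

definition entropy :: "real \<Rightarrow> real" where "entropy x = x * (ln x - 1)"

lemma entropy_bounds:
  assumes "0 \<le> x" "x \<le> 1" shows "- 1 \<le> entropy x" "entropy x \<le> 0"
proof -
  show "entropy x \<le> 0"
  proof (cases "x = 0")
    case False
    then have "ln x \<le> 0" using assms by simp
    then show ?thesis using assms by (simp add: entropy_def mult_nonneg_nonpos)
  qed (simp add: entropy_def)
  show "- 1 \<le> entropy x"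
  proof (cases "x = 0")
    case False
    then have x: "x > 0" using assms by simp
    have "ln (1 / x) \<le> 1 / x - 1" using x by (intro ln_le_minus_one) simp
    then have "1 - 1 / x \<le> ln x" using x by (simp add: ln_div)
    then have "x * (1 - 1 / x) \<le> x * ln x" using x by (intro mult_left_mono) auto
    then show ?thesis using x by (simp add: entropy_def algebra_simps)
  qed (simp add: entropy_def)
qed

text \<open>The graph of a convex function lies above its tangent, here at \<open>x\<close>. The value \<open>y = 0\<close> has to be
  allowed, because the initial concentration may vanish on a cell.\<close>

lemma entropy_convex:
  assumes "x > 0" "y \<ge> 0" shows "entropy x - entropy y \<le> ln x * (x - y)"
proof (cases "y = 0")
  case False
  then have y: "y > 0" using assms by simp
  have "ln (x / y) \<le> x / y - 1" using assms(1) y by (intro ln_le_minus_one) simp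
  then have "ln x - ln y \<le> x / y - 1" using assms(1) y by (simp add: ln_div)
  then have "y * (ln x - ln y) \<le> y * (x / y - 1)" using y by (intro mult_left_mono) auto
  then show ?thesis using y by (simp add: entropy_def algebra_simps)
qed (use assms in \<open>simp add: entropy_def algebra_simps\<close>)

section \<open>Positivity of the concentrations\<close>

locale discrete_solution = mesh_on +
  fixes T \<alpha> \<kappa> \<rho> :: real and N :: nat and \<eta> \<theta> :: "nat \<Rightarrow> real" and \<Psi> c0 :: "nat \<Rightarrow> plane \<Rightarrow> real"
    and c \<mu> :: "nat \<Rightarrow> nat \<Rightarrow> plane set \<Rightarrow> real"
  assumes T: "T > 0" and \<alpha>: "\<alpha> > 0" and \<rho>: "\<rho> > 0" and N: "N \<ge> 1"
    and \<eta>: "\<And>i. i \<in> {1,2} \<Longrightarrow> \<eta> i > 0"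
    and \<Psi>: "\<And>i. i \<in> {1,2} \<Longrightarrow> L2 \<Omega> (\<Psi> i)"
    and initial: "initial_data \<Omega> c0"
    and scheme: "scheme_solution M T N \<alpha> \<kappa> \<rho> \<eta> \<theta> \<Psi> c0 c \<mu>"
begin

definition dt :: real where "dt = T / real N"

lemma dt: "dt > 0" "real N * dt = T"
  using T N by (auto simp: dt_def)

definition potential :: "nat \<Rightarrow> nat \<Rightarrow> plane set \<Rightarrow> real" where
  "potential n i K = \<mu> n i K + cell_mean (\<Psi> i) K"

definition flux :: "nat \<Rightarrow> nat \<Rightarrow> plane set \<Rightarrow> plane set \<Rightarrow> plane set \<Rightarrow> real" where
  "flux n i \<sigma> K L = transmissivity M \<sigma> *
    (edge_conc (c n i K) (c n i L) / \<eta> i * (potential n i K - potential n i L) +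
     theta_mesh M \<rho> (\<theta> i) * (c n i K - c n i L))"

lemma flux_antisym: "flux n i \<sigma> L K = - flux n i \<sigma> K L"
proof -
  have "edge_conc (c n i L) (c n i K) = edge_conc (c n i K) (c n i L)" by (rule edge_conc_commute)
  then show ?thesis by (simp add: flux_def algebra_simps diff_divide_distrib)
qed

lemma mass_balance:
  assumes "n \<in> {1..N}" "i \<in> {1,2}" "K \<in> cells M"
  shows "area K * (c n i K - c (n - 1) i K) =
    - dt * (\<Sum>\<sigma>\<in>interior_edges_of M K. flux n i \<sigma> K (neighbour M K \<sigma>))"
proof -
  have "area K * ((c n i K - c (n - 1) i K) / dt) +
      (\<Sum>\<sigma>\<in>interior_edges_of M K. flux n i \<sigma> K (neighbour M K \<sigma>)) = 0"
    using scheme assms unfolding scheme_solution_def flux_def potential_def dt_def Let_def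
    by (fastforce simp: diff_diff_eq add_diff_eq)
  then show ?thesis using dt(1) by (simp add: field_simps)
qed

lemma chemical_potential:
  assumes "n \<in> {1..N}" "K \<in> cells M"
  shows "\<mu> n 1 K - \<mu> n 2 K =
    \<alpha> / area K * flux_sum M (c n 1) K + \<kappa> * (1 - 2 * c (n - 1) 1 K)"
  using scheme assms unfolding scheme_solution_def by blast

lemma tested_mass_balance:
  assumes "n \<in> {1..N}" "i \<in> {1,2}"
  shows "(\<Sum>K\<in>cells M. area K * (c n i K - c (n - 1) i K) * \<phi> K) =
    - dt * edge_sum (\<lambda>\<sigma> K L. flux n i \<sigma> K L * (\<phi> K - \<phi> L))"
proof -
  have "(\<Sum>K\<in>cells M. area K * (c n i K - c (n - 1) i K) * \<phi> K) =
      (\<Sum>K\<in>cells M. - dt * ((\<Sum>\<sigma>\<in>interior_edges_of M K. flux n i \<sigma> K (neighbour M K \<sigma>)) * \<phi> K))"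
  proof (rule sum.cong[OF refl])
    fix K assume K: "K \<in> cells M"
    show "area K * (c n i K - c (n - 1) i K) * \<phi> K =
        - dt * ((\<Sum>\<sigma>\<in>interior_edges_of M K. flux n i \<sigma> K (neighbour M K \<sigma>)) * \<phi> K)"
      unfolding mass_balance[OF assms K] by (simp only: mult.assoc)
  qed
  also have "\<dots> = - dt * (\<Sum>K\<in>cells M. (\<Sum>\<sigma>\<in>interior_edges_of M K. flux n i \<sigma> K (neighbour M K \<sigma>)) * \<phi> K)"
    by (simp only: sum_distrib_left)
  also have "\<dots> = - dt * edge_sum (\<lambda>\<sigma> K L. flux n i \<sigma> K L * (\<phi> K - \<phi> L))"
    by (subst summation_by_parts[where G = "flux n i"]) (rule flux_antisym refl)+
  finally show ?thesis .
qed

lemma mass_conservation: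
  assumes "n \<in> {1..N}" "i \<in> {1,2}"
  shows "(\<Sum>K\<in>cells M. area K * c n i K) = (\<Sum>K\<in>cells M. area K * c (n - 1) i K)"
  using tested_mass_balance[OF assms, of "\<lambda>_. 1"]
  by (simp add: edge_sum_def algebra_simps sum_subtractf split_def)

lemma initial_L2: "i \<in> {1,2} \<Longrightarrow> L2 \<Omega> (c0 i)"
  using initial by (auto simp: initial_data_def H1_def)

lemma initial_conc: "K \<in> cells M \<Longrightarrow> i \<in> {1,2} \<Longrightarrow> c 0 i K = cell_mean (c0 i) K"
  using scheme unfolding scheme_solution_def by blast

lemma initial_mass_pos:
  assumes i: "i \<in> {1,2}" shows "(\<Sum>K\<in>cells M. area K * c 0 i K) > 0"
proof -
  have "(\<Sum>K\<in>cells M. area K * c 0 i K) = (\<Sum>K\<in>cells M. LINT x:K|lebesgue. c0 i x)"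
  proof (rule sum.cong[OF refl])
    fix K assume K: "K \<in> cells M"
    show "area K * c 0 i K = (LINT x:K|lebesgue. c0 i x)"
      using cell_area_pos[OF K] by (simp add: initial_conc[OF K i] cell_mean_def)
  qed
  also have "\<dots> = (LINT x:\<Omega>|lebesgue. c0 i x)"
    by (intro sum_integral_cells L2_integrable[OF initial_L2[OF i]] domain_lmeasurable)
  finally show ?thesis using initial i by (auto simp: initial_data_def)
qed

lemma cells_nonempty: "cells M \<noteq> {}"
  using initial_mass_pos[of 1] by auto

lemma theta_mesh_pos: "theta_mesh M \<rho> (\<theta> i) > 0"
  using \<rho> mesh_size_pos[OF cells_nonempty] by (simp add: theta_mesh_def less_max_iff_disj)

lemma initial_conc_nonneg:
  assumes "K \<in> cells M" "i \<in> {1,2}" shows "0 \<le> c 0 i K"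
proof -
  have "AE x in lebesgue. x \<in> \<Omega> \<longrightarrow> 0 \<le> c0 i x"
    using initial assms(2) unfolding initial_data_def by blast
  then have "AE x in lebesgue. 0 \<le> indicator K x *\<^sub>R c0 i x"
    by eventually_elim (use cell_subset_domain[OF assms(1)] in \<open>auto simp: indicator_def\<close>)
  then have "0 \<le> (LINT x:K|lebesgue. c0 i x)"
    unfolding set_lebesgue_integral_def by (rule integral_nonneg_AE)
  then show ?thesis using assms by (simp add: initial_conc cell_mean_def)
qed

lemma initial_conc_sum:
  assumes K: "K \<in> cells M" shows "c 0 1 K + c 0 2 K = 1"
proof -
  have int: "set_integrable lebesgue K (c0 i)" if "i \<in> {1,2}" for i
    using L2_integrable[OF L2_subset[OF initial_L2[OF that]]] cell_lmeasurable[OF K]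
      cell_subset_domain[OF K] fmeasurableD by blast
  have "(LINT x:K|lebesgue. c0 1 x) + (LINT x:K|lebesgue. c0 2 x) = (LINT x:K|lebesgue. c0 1 x + c0 2 x)"
    using int[of 1] int[of 2] by simp
  also have "\<dots> = (LINT x:K|lebesgue. 1)"
    unfolding set_lebesgue_integral_def
  proof (rule integral_cong_AE)
    have "set_integrable lebesgue K (\<lambda>x. c0 1 x + c0 2 x)"
      using int[of 1] int[of 2] by (intro set_integral_add) auto
    then show "(\<lambda>x. indicator K x *\<^sub>R (c0 1 x + c0 2 x)) \<in> borel_measurable lebesgue"
      by (auto simp: set_integrable_def)
    show "(\<lambda>x. indicator K x *\<^sub>R (1::real)) \<in> borel_measurable lebesgue"
      using set_integrable_const[OF cell_lmeasurable[OF K], of 1] by (auto simp: set_integrable_def)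
    have "AE x in lebesgue. x \<in> \<Omega> \<longrightarrow> c0 1 x + c0 2 x = 1"
      using initial by (simp add: initial_data_def)
    then show "AE x in lebesgue. indicator K x *\<^sub>R (c0 1 x + c0 2 x) = indicator K x *\<^sub>R 1"
      by eventually_elim (use cell_subset_domain[OF K] in \<open>auto simp: indicator_def\<close>)
  qed
  also have "\<dots> = area K" using set_integral_const_lmeasurable[OF cell_lmeasurable[OF K], of 1] by simp
  finally show ?thesis using cell_area_pos[OF K] K
    by (simp add: initial_conc cell_mean_def flip: add_divide_distrib)
qed

lemma conc_sum:
  assumes "n \<le> N" "K \<in> cells M" shows "c n 1 K + c n 2 K = 1"
proof (cases "n = 0")
  case True then show ?thesis using initial_conc_sum assms by simp
next
  case False
  then have "n \<in> {1..N}" using assms by simp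
  then show ?thesis using scheme assms(2) unfolding scheme_solution_def by blast
qed

text \<open>At a nonpositive minimum every edge concentration of \<open>K\<close> is zero, so only diffusion is left. It
  cannot lower the value of the cell, hence the value is squeezed between the nonnegative previous
  value and 0. Then nothing flows, and since the diffusion coefficient is positive the neighbours
  have the same value.\<close>

lemma min_cell_spreads:
  assumes n: "n \<in> {1..N}" and i: "i \<in> {1,2}" and K: "K \<in> cells M"
    and prev: "0 \<le> c (n - 1) i K"
    and min: "\<And>L. L \<in> cells M \<Longrightarrow> c n i K \<le> c n i L" and nonpos: "c n i K \<le> 0"
  shows "c n i K = 0" "\<And>\<sigma> L. is_interface M \<sigma> K L \<Longrightarrow> c n i L = 0"
proof -
  let ?g = "\<lambda>\<sigma>. transmissivity M \<sigma> * (c n i (neighbour M K \<sigma>) - c n i K)"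
  have nb: "neighbour M K \<sigma> \<in> cells M" "\<sigma> \<in> interior_edges M" if "\<sigma> \<in> interior_edges_of M K" for \<sigma>
  proof -
    obtain L where "is_interface M \<sigma> K L" using \<open>\<sigma> \<in> interior_edges_of M K\<close> interior_edges_of_iff by blast
    moreover from this have "L \<in> cells M" unfolding is_interface_def by blast
    ultimately show "neighbour M K \<sigma> \<in> cells M" "\<sigma> \<in> interior_edges M"
      using neighbour_eq interior_edges_iff by auto
  qed
  have g: "0 \<le> ?g \<sigma>" if "\<sigma> \<in> interior_edges_of M K" for \<sigma>
    using transmissivity_pos[OF nb(2)[OF that]] min[OF nb(1)[OF that]] by simp
  have "flux n i \<sigma> K (neighbour M K \<sigma>) = - theta_mesh M \<rho> (\<theta> i) * ?g \<sigma>"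
    if "\<sigma> \<in> interior_edges_of M K" for \<sigma>
    using edge_conc_at_nonpos_min[OF nonpos min[OF nb(1)[OF that]]]
    by (simp add: flux_def algebra_simps)
  then have "area K * (c n i K - c (n - 1) i K) =
      - dt * (\<Sum>\<sigma>\<in>interior_edges_of M K. - theta_mesh M \<rho> (\<theta> i) * ?g \<sigma>)"
    using mass_balance[OF n i K] by simp
  also have "\<dots> = dt * theta_mesh M \<rho> (\<theta> i) * (\<Sum>\<sigma>\<in>interior_edges_of M K. ?g \<sigma>)"
    by (simp add: sum_distrib_left sum_negf mult.assoc)
  finally have bal: "area K * (c n i K - c (n - 1) i K) =
      dt * theta_mesh M \<rho> (\<theta> i) * (\<Sum>\<sigma>\<in>interior_edges_of M K. ?g \<sigma>)" .
  have sum0: "0 \<le> (\<Sum>\<sigma>\<in>interior_edges_of M K. ?g \<sigma>)" using g by (rule sum_nonneg)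
  have "0 \<le> area K * (c n i K - c (n - 1) i K)"
    unfolding bal using sum0 dt(1) theta_mesh_pos[of i] by simp
  then have "c (n - 1) i K \<le> c n i K" using cell_area_pos[OF K] by (simp add: zero_le_mult_iff)
  then show zero: "c n i K = 0" using prev nonpos by simp
  have "c (n - 1) i K = 0" using \<open>c (n - 1) i K \<le> c n i K\<close> prev zero by simp
  then have "dt * theta_mesh M \<rho> (\<theta> i) * (\<Sum>\<sigma>\<in>interior_edges_of M K. ?g \<sigma>) = 0"
    using bal zero by simp
  then have "(\<Sum>\<sigma>\<in>interior_edges_of M K. ?g \<sigma>) = 0" using dt(1) theta_mesh_pos[of i] by simp
  then have g0: "?g \<sigma> = 0" if "\<sigma> \<in> interior_edges_of M K" for \<sigma>
    using sum_nonneg_eq_0_iff[OF finite_interior_edges(2), of K ?g] g that by blast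
  show "c n i L = 0" if "is_interface M \<sigma> K L" for \<sigma> L
  proof -
    have "\<sigma> \<in> interior_edges_of M K" using that interior_edges_of_iff by blast
    then show ?thesis
      using g0[of \<sigma>] transmissivity_pos[OF nb(2)[of \<sigma>]] neighbour_eq[OF that] zero by simp
  qed
qed

text \<open>A discrete strong maximum principle. The cells with value zero are closed under passing to a
  neighbour; if there is one, the connected mesh has concentration zero everywhere, against the
  conservation of mass.\<close>

lemma conc_pos_step:
  assumes n: "n \<in> {1..N}" and i: "i \<in> {1,2}"
    and prev: "\<And>K. K \<in> cells M \<Longrightarrow> 0 \<le> c (n - 1) i K"
    and mass: "(\<Sum>K\<in>cells M. area K * c (n - 1) i K) > 0"
    and K: "K \<in> cells M"
  shows "c n i K > 0"
proof (rule ccontr)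
  assume "\<not> c n i K > 0"
  define A where "A = {K \<in> cells M. c n i K = 0}"
  define m where "m = Min (c n i ` cells M)"
  have m_le: "m \<le> c n i L" if "L \<in> cells M" for L
    using that finite_cells by (simp add: m_def)
  have "m \<in> c n i ` cells M" using finite_cells cells_nonempty by (simp add: m_def)
  then obtain K0 where K0: "K0 \<in> cells M" "c n i K0 = m" by auto
  have "m \<le> 0" using m_le[OF K] \<open>\<not> c n i K > 0\<close> by simp
  then have "m = 0" using min_cell_spreads(1)[OF n i K0(1) prev[OF K0(1)]] m_le K0(2) by simp
  have "A = cells M"
  proof (rule cells_connected)
    show "A \<subseteq> cells M" "A \<noteq> {}" using K0 \<open>m = 0\<close> by (auto simp: A_def)
    show "L \<in> A" if "is_interface M \<sigma> K L" "K \<in> A" for \<sigma> K L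
      using min_cell_spreads(2)[OF n i _ prev _ _ that(1)] that m_le \<open>m = 0\<close>
      by (auto simp: A_def is_interface_def)
  qed
  then have "(\<Sum>K\<in>cells M. area K * c n i K) = 0" by (auto simp: A_def intro!: sum.neutral)
  then show False using mass mass_conservation[OF n i] by simp
qed

lemma conc_nonneg_mass_pos:
  assumes i: "i \<in> {1,2}" and "n \<le> N"
  shows "(\<forall>K\<in>cells M. 0 \<le> c n i K) \<and> (\<Sum>K\<in>cells M. area K * c n i K) > 0"
  using \<open>n \<le> N\<close>
proof (induction n)
  case 0 then show ?case using initial_conc_nonneg initial_mass_pos i by blast
next
  case (Suc n)
  then have n: "Suc n \<in> {1..N}" by simp
  show ?case
    using conc_pos_step[OF n i] Suc mass_conservation[OF n i] by (auto intro: less_imp_le)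
qed

lemma conc_pos: "n \<in> {1..N} \<Longrightarrow> i \<in> {1,2} \<Longrightarrow> K \<in> cells M \<Longrightarrow> c n i K > 0"
  using conc_nonneg_mass_pos[of i "n - 1"] by (intro conc_pos_step) auto

lemma conc_bounds:
  assumes "n \<le> N" "i \<in> {1,2}" "K \<in> cells M" shows "0 \<le> c n i K" "c n i K \<le> 1"
  using conc_nonneg_mass_pos[of 1 n] conc_nonneg_mass_pos[of 2 n] conc_sum[of n K] assms by force+

section \<open>Entropy dissipation in one time step\<close>

definition total_entropy :: "nat \<Rightarrow> real" where
  "total_entropy n = (\<Sum>i\<in>{1,2}. \<eta> i * (\<Sum>K\<in>cells M. area K * entropy (c n i K)))"

definition laplacian_energy :: "nat \<Rightarrow> real" where
  "laplacian_energy n = (\<Sum>K\<in>cells M. area K * (1 / area K * flux_sum M (c n 1) K)\<^sup>2)"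

text \<open>The discrete counterpart of the Fisher information \<open>\<integral>\<nabla>c \<cdot> \<nabla>(ln c) = \<integral>\<bar>\<nabla>c\<bar>\<^sup>2 / c\<close>.\<close>

definition fisher :: "nat \<Rightarrow> nat \<Rightarrow> real" where
  "fisher n i = edge_sum (\<lambda>\<sigma> K L.
     transmissivity M \<sigma> * (c n i K - c n i L) * (ln (c n i K) - ln (c n i L)))"

definition fisher_information :: "nat \<Rightarrow> real" where
  "fisher_information n = (\<Sum>i\<in>{1,2}. \<eta> i * theta_mesh M \<rho> (\<theta> i) * fisher n i)"

definition potential_norm :: real where
  "potential_norm = 2 * ((LINT x:\<Omega>|lebesgue. (\<Psi> 1 x)\<^sup>2) + (LINT x:\<Omega>|lebesgue. (\<Psi> 2 x)\<^sup>2))"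

lemma total_entropy_bounds:
  assumes "n \<le> N"
  shows "- ((\<eta> 1 + \<eta> 2) * area \<Omega>) \<le> total_entropy n" "total_entropy n \<le> 0"
proof -
  have *: "- area \<Omega> \<le> (\<Sum>K\<in>cells M. area K * entropy (c n i K))"
    "(\<Sum>K\<in>cells M. area K * entropy (c n i K)) \<le> 0" if i: "i \<in> {1,2}" for i
  proof -
    have "(\<Sum>K\<in>cells M. area K * (- 1)) \<le> (\<Sum>K\<in>cells M. area K * entropy (c n i K))"
      using entropy_bounds conc_bounds[OF assms i] by (intro sum_mono mult_left_mono) auto
    then show "- area \<Omega> \<le> (\<Sum>K\<in>cells M. area K * entropy (c n i K))"
      by (simp add: sum_negf sum_area)
    show "(\<Sum>K\<in>cells M. area K * entropy (c n i K)) \<le> 0"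
      using entropy_bounds conc_bounds[OF assms i] by (intro sum_nonpos mult_nonneg_nonpos) auto
  qed
  have "\<eta> i * (- area \<Omega>) \<le> \<eta> i * (\<Sum>K\<in>cells M. area K * entropy (c n i K))"
    "\<eta> i * (\<Sum>K\<in>cells M. area K * entropy (c n i K)) \<le> 0" if i: "i \<in> {1,2}" for i
    using *[OF i] \<eta>[OF i] by (intro mult_left_mono mult_nonneg_nonpos; simp)+
  from this[of 1] this[of 2] show "- ((\<eta> 1 + \<eta> 2) * area \<Omega>) \<le> total_entropy n" "total_entropy n \<le> 0"
    by (auto simp: total_entropy_def algebra_simps)
qed

lemma fisher_nonneg:
  assumes "n \<in> {1..N}" "i \<in> {1,2}" shows "0 \<le> fisher n i"
  unfolding fisher_def
proof (rule edge_sum_nonneg)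
  fix \<sigma> K L assume "\<sigma> \<in> interior_edges M" "K \<in> cells M" "L \<in> cells M"
  moreover have "0 \<le> (x - y) * (ln x - ln y)" if "x > 0" "y > 0" for x y :: real
    using that by (cases "x \<le> y") (auto intro: mult_nonneg_nonneg mult_nonpos_nonpos)
  ultimately show "0 \<le> transmissivity M \<sigma> * (c n i K - c n i L) * (ln (c n i K) - ln (c n i L))"
    using transmissivity_pos conc_pos[OF assms] by (simp add: mult.assoc less_imp_le)
qed

lemma fisher_information_nonneg: "n \<in> {1..N} \<Longrightarrow> 0 \<le> fisher_information n"
  unfolding fisher_information_def using fisher_nonneg \<eta> theta_mesh_pos
  by (intro sum_nonneg mult_nonneg_nonneg) (auto intro: less_imp_le)

lemma laplacian_energy_nonneg: "0 \<le> laplacian_energy n"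
  unfolding laplacian_energy_def by (intro sum_nonneg) simp

text \<open>The mobility \<open>c\<^sub>i\<^sub>\<sigma> / \<eta>\<^sub>i\<close> is degenerate, but the factor \<open>\<eta>\<^sub>i\<close> and the chain rule for the
  logarithmic mean remove it completely.\<close>

lemma log_tested_flux:
  assumes n: "n \<in> {1..N}" and i: "i \<in> {1,2}"
  shows "\<eta> i * edge_sum (\<lambda>\<sigma> K L. flux n i \<sigma> K L * (ln (c n i K) - ln (c n i L))) =
    edge_sum (\<lambda>\<sigma> K L. transmissivity M \<sigma> * (c n i K - c n i L) * (potential n i K - potential n i L)) +
    \<eta> i * theta_mesh M \<rho> (\<theta> i) * fisher n i"
proof -
  have "\<eta> i * edge_sum (\<lambda>\<sigma> K L. flux n i \<sigma> K L * (ln (c n i K) - ln (c n i L))) =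
    edge_sum (\<lambda>\<sigma> K L. \<eta> i * (flux n i \<sigma> K L * (ln (c n i K) - ln (c n i L))))"
    by (simp only: edge_sum_cmult)
  also have "\<dots> = edge_sum (\<lambda>\<sigma> K L.
      transmissivity M \<sigma> * (c n i K - c n i L) * (potential n i K - potential n i L) +
      (\<eta> i * theta_mesh M \<rho> (\<theta> i)) *
        (transmissivity M \<sigma> * (c n i K - c n i L) * (ln (c n i K) - ln (c n i L))))"
  proof (rule edge_sum_cong)
    fix \<sigma> K L assume KL: "K \<in> cells M" "L \<in> cells M"
    let ?d = "ln (c n i K) - ln (c n i L)" and ?e = "edge_conc (c n i K) (c n i L)"
    have e: "?e * ?d = c n i K - c n i L"
      by (intro edge_conc_log_difference conc_pos n i KL)
    have "\<eta> i * (flux n i \<sigma> K L * ?d) = transmissivity M \<sigma> * ((?e * ?d) *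
        (potential n i K - potential n i L)) +
      (\<eta> i * theta_mesh M \<rho> (\<theta> i)) * (transmissivity M \<sigma> * (c n i K - c n i L) * ?d)"
      using \<eta>[OF i] by (simp add: flux_def field_simps)
    then show "\<eta> i * (flux n i \<sigma> K L * ?d) =
      transmissivity M \<sigma> * (c n i K - c n i L) * (potential n i K - potential n i L) +
      (\<eta> i * theta_mesh M \<rho> (\<theta> i)) * (transmissivity M \<sigma> * (c n i K - c n i L) * ?d)"
      unfolding e by (simp add: mult.assoc)
  qed
  finally show ?thesis by (simp add: edge_sum_add edge_sum_cmult fisher_def)
qed

text \<open>The differences of the two concentrations across an edge are opposite, because the
  concentrations add up to 1. So only the difference of the two potentials remains, and it is
  known from the scheme, whereas the individual potentials are not controlled.\<close>

lemma species_coupling: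
  assumes n: "n \<in> {1..N}"
  shows "(\<Sum>i\<in>{1,2}. edge_sum (\<lambda>\<sigma> K L.
      transmissivity M \<sigma> * (c n i K - c n i L) * (potential n i K - potential n i L))) =
    (\<Sum>K\<in>cells M. flux_sum M (c n 1) K * (potential n 1 K - potential n 2 K))"
proof -
  have "edge_sum (\<lambda>\<sigma> K L. transmissivity M \<sigma> * (c n 1 K - c n 1 L) *
        ((potential n 1 K - potential n 2 K) - (potential n 1 L - potential n 2 L))) =
    edge_sum (\<lambda>\<sigma> K L. transmissivity M \<sigma> * (c n 1 K - c n 1 L) * (potential n 1 K - potential n 1 L) +
        transmissivity M \<sigma> * (c n 2 K - c n 2 L) * (potential n 2 K - potential n 2 L))"
  proof (rule edge_sum_cong)
    fix \<sigma> K L assume "K \<in> cells M" "L \<in> cells M"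
    then have c2: "c n 2 K = 1 - c n 1 K" "c n 2 L = 1 - c n 1 L"
      using conc_sum[of n] n by (simp_all add: eq_diff_eq add.commute)
    show "transmissivity M \<sigma> * (c n 1 K - c n 1 L) *
        ((potential n 1 K - potential n 2 K) - (potential n 1 L - potential n 2 L)) =
      transmissivity M \<sigma> * (c n 1 K - c n 1 L) * (potential n 1 K - potential n 1 L) +
        transmissivity M \<sigma> * (c n 2 K - c n 2 L) * (potential n 2 K - potential n 2 L)"
      unfolding c2 by (simp add: algebra_simps)
  qed
  then show ?thesis by (simp add: flux_sum_by_parts edge_sum_add)
qed

lemma potential_difference_square_sum:
  "(\<Sum>K\<in>cells M. area K * (cell_mean (\<Psi> 1) K - cell_mean (\<Psi> 2) K)\<^sup>2) \<le> potential_norm"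
proof -
  have sq: "(x - y)\<^sup>2 \<le> 2 * x\<^sup>2 + 2 * y\<^sup>2" for x y :: real
  proof -
    have "0 \<le> (x + y)\<^sup>2" by simp
    then show ?thesis by (simp add: power2_eq_square algebra_simps)
  qed
  have "(\<Sum>K\<in>cells M. area K * (cell_mean (\<Psi> 1) K - cell_mean (\<Psi> 2) K)\<^sup>2) \<le>
      (\<Sum>K\<in>cells M. area K * (2 * (cell_mean (\<Psi> 1) K)\<^sup>2 + 2 * (cell_mean (\<Psi> 2) K)\<^sup>2))"
    by (intro sum_mono mult_left_mono sq) simp
  also have "\<dots> = 2 * ((\<Sum>K\<in>cells M. area K * (cell_mean (\<Psi> 1) K)\<^sup>2) +
      (\<Sum>K\<in>cells M. area K * (cell_mean (\<Psi> 2) K)\<^sup>2))"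
    by (simp add: sum_distrib_left sum.distrib algebra_simps)
  also have "\<dots> \<le> potential_norm"
    unfolding potential_norm_def
    using sum_cell_mean_square_le[OF \<Psi>[of 1]] sum_cell_mean_square_le[OF \<Psi>[of 2]] by simp
  finally show ?thesis .
qed

lemma centred_conc_square_le:
  assumes "n \<le> N" "K \<in> cells M" shows "(1 - 2 * c n 1 K)\<^sup>2 \<le> 1"
proof -
  have "\<bar>1 - 2 * c n 1 K\<bar> \<le> 1" using conc_bounds[OF assms(1) _ assms(2), of 1] by (simp add: abs_le_iff)
  then show ?thesis by (simp add: abs_square_le_1)
qed

text \<open>The difference of the potentials is \<open>\<alpha> f + r + \<psi>\<close> with \<open>f = F / m\<close>, a bounded \<open>r\<close> coming from
  the previous time step and \<open>\<psi>\<close> from the external potentials. Young's inequality gives up half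
  of \<open>\<alpha> f\<^sup>2\<close> to absorb \<open>f (r + \<psi>)\<close>.\<close>

lemma coupling_lower_bound:
  assumes n: "n \<in> {1..N}"
  shows "\<alpha> / 2 * laplacian_energy n - (\<kappa>\<^sup>2 * area \<Omega> + potential_norm) / \<alpha>
    \<le> (\<Sum>K\<in>cells M. flux_sum M (c n 1) K * (potential n 1 K - potential n 2 K))"
proof -
  define f where "f K = 1 / area K * flux_sum M (c n 1) K" for K
  define \<psi> where "\<psi> K = cell_mean (\<Psi> 1) K - cell_mean (\<Psi> 2) K" for K
  have young: "\<alpha> / 2 * x\<^sup>2 - (r\<^sup>2 + s\<^sup>2) / \<alpha> \<le> x * (\<alpha> * x + r + s)" for x r s :: real
  proof -
    \<comment> \<open>This sum of squares divided by \<open>2 \<alpha>\<close> is the gap of the inequality.\<close>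
    have "0 \<le> (\<alpha> * x + r + s)\<^sup>2 + (r - s)\<^sup>2" by simp
    then have "0 \<le> ((\<alpha> * x + r + s)\<^sup>2 + (r - s)\<^sup>2) / (2 * \<alpha>)" using \<alpha> by simp
    also have "\<dots> = x * (\<alpha> * x + r + s) - (\<alpha> / 2 * x\<^sup>2 - (r\<^sup>2 + s\<^sup>2) / \<alpha>)"
      using \<alpha> by (simp add: field_simps power2_eq_square)
    finally show ?thesis by simp
  qed
  have "\<alpha> / 2 * (area K * (f K)\<^sup>2) - (\<kappa>\<^sup>2 * area K + area K * (\<psi> K)\<^sup>2) / \<alpha>
      \<le> flux_sum M (c n 1) K * (potential n 1 K - potential n 2 K)" if K: "K \<in> cells M" for K
  proof -
    define r where "r = \<kappa> * (1 - 2 * c (n - 1) 1 K)"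
    have "r\<^sup>2 \<le> \<kappa>\<^sup>2 * 1" unfolding r_def power_mult_distrib
      using centred_conc_square_le[of "n - 1" K] n K by (intro mult_left_mono) auto
    then have "(r\<^sup>2 + (\<psi> K)\<^sup>2) / \<alpha> \<le> (\<kappa>\<^sup>2 + (\<psi> K)\<^sup>2) / \<alpha>" using \<alpha> by (intro divide_right_mono) auto
    then have "\<alpha> / 2 * (f K)\<^sup>2 - (\<kappa>\<^sup>2 + (\<psi> K)\<^sup>2) / \<alpha> \<le> f K * (\<alpha> * f K + r + \<psi> K)"
      using young[of "f K" r "\<psi> K"] by linarith
    then have "area K * (\<alpha> / 2 * (f K)\<^sup>2 - (\<kappa>\<^sup>2 + (\<psi> K)\<^sup>2) / \<alpha>) \<le> area K * (f K * (\<alpha> * f K + r + \<psi> K))"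
      by (intro mult_left_mono) auto
    moreover have "potential n 1 K - potential n 2 K = \<alpha> * f K + r + \<psi> K"
      using chemical_potential[OF n K] by (simp add: potential_def f_def r_def \<psi>_def)
    moreover have "area K * f K = flux_sum M (c n 1) K" using cell_area_pos[OF K] by (simp add: f_def)
    then have "area K * (f K * (\<alpha> * f K + r + \<psi> K)) = flux_sum M (c n 1) K * (\<alpha> * f K + r + \<psi> K)"
      by (simp flip: mult.assoc)
    ultimately show ?thesis by (simp add: algebra_simps add_divide_distrib)
  qed
  then have "(\<Sum>K\<in>cells M. \<alpha> / 2 * (area K * (f K)\<^sup>2) - (\<kappa>\<^sup>2 * area K + area K * (\<psi> K)\<^sup>2) / \<alpha>)
      \<le> (\<Sum>K\<in>cells M. flux_sum M (c n 1) K * (potential n 1 K - potential n 2 K))"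
    by (rule sum_mono)
  moreover have "(\<Sum>K\<in>cells M. \<alpha> / 2 * (area K * (f K)\<^sup>2) - (\<kappa>\<^sup>2 * area K + area K * (\<psi> K)\<^sup>2) / \<alpha>) =
      \<alpha> / 2 * laplacian_energy n - (\<kappa>\<^sup>2 * area \<Omega> + (\<Sum>K\<in>cells M. area K * (\<psi> K)\<^sup>2)) / \<alpha>"
    by (simp add: laplacian_energy_def f_def sum_subtractf sum.distrib sum_distrib_left
        flip: sum_area sum_divide_distrib)
  moreover have "(\<kappa>\<^sup>2 * area \<Omega> + (\<Sum>K\<in>cells M. area K * (\<psi> K)\<^sup>2)) / \<alpha> \<le> (\<kappa>\<^sup>2 * area \<Omega> + potential_norm) / \<alpha>"
    using potential_difference_square_sum \<alpha> by (intro divide_right_mono) (auto simp: \<psi>_def)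
  ultimately show ?thesis by linarith
qed

lemma entropy_step:
  assumes n: "n \<in> {1..N}"
  shows "dt * (\<alpha> / 2 * laplacian_energy n + fisher_information n) \<le>
    total_entropy (n - 1) - total_entropy n + dt * ((\<kappa>\<^sup>2 * area \<Omega> + potential_norm) / \<alpha>)"
proof -
  define R where "R = (\<kappa>\<^sup>2 * area \<Omega> + potential_norm) / \<alpha>"
  define S where "S = (\<Sum>K\<in>cells M. flux_sum M (c n 1) K * (potential n 1 K - potential n 2 K))"
  define P where "P i = edge_sum (\<lambda>\<sigma> K L.
      transmissivity M \<sigma> * (c n i K - c n i L) * (potential n i K - potential n i L))" for i
  have "\<eta> i * (\<Sum>K\<in>cells M. area K * entropy (c n i K)) -
      \<eta> i * (\<Sum>K\<in>cells M. area K * entropy (c (n - 1) i K)) \<le>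
      - dt * (P i + \<eta> i * theta_mesh M \<rho> (\<theta> i) * fisher n i)" if i: "i \<in> {1,2}" for i
  proof -
    have "(\<Sum>K\<in>cells M. area K * (entropy (c n i K) - entropy (c (n - 1) i K))) \<le>
        (\<Sum>K\<in>cells M. area K * (ln (c n i K) * (c n i K - c (n - 1) i K)))"
      using n i conc_bounds(1)[of "n - 1" i]
      by (intro sum_mono mult_left_mono entropy_convex conc_pos) auto
    also have "\<dots> = - dt * edge_sum (\<lambda>\<sigma> K L. flux n i \<sigma> K L * (ln (c n i K) - ln (c n i L)))"
      using tested_mass_balance[OF n i, of "\<lambda>K. ln (c n i K)"] by (simp add: ac_simps)
    finally have "\<eta> i * (\<Sum>K\<in>cells M. area K * (entropy (c n i K) - entropy (c (n - 1) i K))) \<le>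
        \<eta> i * (- dt * edge_sum (\<lambda>\<sigma> K L. flux n i \<sigma> K L * (ln (c n i K) - ln (c n i L))))"
      using \<eta>[OF i] by (intro mult_left_mono) auto
    also have "\<dots> = - dt * (\<eta> i * edge_sum (\<lambda>\<sigma> K L. flux n i \<sigma> K L * (ln (c n i K) - ln (c n i L))))"
      by simp
    finally show ?thesis
      unfolding log_tested_flux[OF n i] P_def by (simp add: right_diff_distrib sum_subtractf)
  qed
  then have "(\<Sum>i\<in>{1,2}. \<eta> i * (\<Sum>K\<in>cells M. area K * entropy (c n i K)) -
      \<eta> i * (\<Sum>K\<in>cells M. area K * entropy (c (n - 1) i K))) \<le>
      (\<Sum>i\<in>{1,2}. - dt * (P i + \<eta> i * theta_mesh M \<rho> (\<theta> i) * fisher n i))"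
    by (rule sum_mono)
  also have "\<dots> = - dt * ((\<Sum>i\<in>{1,2}. P i) + fisher_information n)"
    by (simp add: fisher_information_def algebra_simps)
  also have "(\<Sum>i\<in>{1,2}. P i) = S" unfolding P_def S_def by (rule species_coupling[OF n])
  finally have ent: "total_entropy n - total_entropy (n - 1) \<le> - dt * (S + fisher_information n)"
    by (simp only: total_entropy_def sum_subtractf)
  have "dt * (\<alpha> / 2 * laplacian_energy n - R) \<le> dt * S"
    using coupling_lower_bound[OF n] dt(1) by (intro mult_left_mono) (auto simp: S_def R_def)
  then show ?thesis
    using ent unfolding R_def[symmetric] distrib_left right_diff_distrib mult_minus_left by linarith
qed

section \<open>Summation over the time steps\<close>

text \<open>The first term bounds the entropy that can be lost between the initial and the final time. The
  second one is the production, over the whole time, by the terms that Young's inequality left.\<close>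

definition entropy_budget :: real where
  "entropy_budget = (\<eta> 1 + \<eta> 2) * area \<Omega> + T * ((\<kappa>\<^sup>2 * area \<Omega> + potential_norm) / \<alpha>)"

lemma entropy_estimate:
  "(\<Sum>n=1..N. dt * (\<alpha> / 2 * laplacian_energy n + fisher_information n)) \<le> entropy_budget"
proof -
  define R where "R = dt * ((\<kappa>\<^sup>2 * area \<Omega> + potential_norm) / \<alpha>)"
  have "(\<Sum>n=1..m. dt * (\<alpha> / 2 * laplacian_energy n + fisher_information n)) \<le>
      total_entropy 0 - total_entropy m + real m * R"
    if "m \<le> N" for m
    using that
  proof (induction m)
    case (Suc m)
    have "real (Suc m) * R = real m * R + R" by (simp add: distrib_right)
    then show ?case using Suc entropy_step[of "Suc m", folded R_def] by simp
  qed simp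
  from this[of N] show ?thesis
    using total_entropy_bounds(1)[of N] total_entropy_bounds(2)[of 0]
    unfolding R_def mult.assoc[symmetric] dt(2) by (simp add: entropy_budget_def)
qed

text \<open>Both sums are nonnegative, so each of them is separately bounded in the entropy estimate. The
  weight \<open>\<alpha> / 2\<close> of the first one causes the factor \<open>2 / \<alpha>\<close>.\<close>

lemma fisher_laplacian_bound:
  "(\<Sum>n=1..N. dt * laplacian_energy n) + (\<Sum>n=1..N. dt * fisher_information n)
    \<le> (2 / \<alpha> + 1) * entropy_budget"
proof -
  define X where "X = (\<Sum>n=1..N. dt * laplacian_energy n)"
  define Y where "Y = (\<Sum>n=1..N. dt * fisher_information n)"
  have X: "0 \<le> X" unfolding X_def using dt(1) laplacian_energy_nonneg by (intro sum_nonneg) simp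
  have Y: "0 \<le> Y" unfolding Y_def using dt(1) fisher_information_nonneg by (intro sum_nonneg) simp
  have "\<alpha> / 2 * X + Y \<le> entropy_budget"
    using entropy_estimate by (simp add: X_def Y_def sum.distrib sum_distrib_left algebra_simps)
  moreover have "0 \<le> \<alpha> / 2 * X" using \<alpha> X by simp
  ultimately have "Y \<le> entropy_budget" "\<alpha> / 2 * X \<le> entropy_budget" using Y by linarith+
  moreover from this(2) have "2 / \<alpha> * (\<alpha> / 2 * X) \<le> 2 / \<alpha> * entropy_budget"
    using \<alpha> by (intro mult_left_mono) auto
  moreover have "2 / \<alpha> * (\<alpha> / 2 * X) = X" using \<alpha> by simp
  ultimately show ?thesis unfolding X_def[symmetric] Y_def[symmetric] distrib_right by linarith
qed

text \<open>The scheme expresses \<open>\<mu>\<^sub>1 - \<mu>\<^sub>2\<close> by the discrete Laplacian of \<open>c\<^sub>1\<close> and a term bounded by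
  \<open>\<kappa>\<close>.\<close>

lemma potential_gap_bound:
  "(\<Sum>n=1..N. dt * (\<Sum>K\<in>cells M. area K * (\<mu> n 1 K - \<mu> n 2 K)\<^sup>2)) \<le>
    2 * \<alpha>\<^sup>2 * ((2 / \<alpha> + 1) * entropy_budget) + 2 * \<kappa>\<^sup>2 * T * area \<Omega>"
proof -
  have "(\<Sum>K\<in>cells M. area K * (\<mu> n 1 K - \<mu> n 2 K)\<^sup>2) \<le>
      2 * \<alpha>\<^sup>2 * laplacian_energy n + 2 * \<kappa>\<^sup>2 * area \<Omega>" if n: "n \<in> {1..N}" for n
  proof -
    have "area K * (\<mu> n 1 K - \<mu> n 2 K)\<^sup>2 \<le>
      2 * \<alpha>\<^sup>2 * (area K * (1 / area K * flux_sum M (c n 1) K)\<^sup>2) + 2 * \<kappa>\<^sup>2 * area K"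
      if K: "K \<in> cells M" for K
    proof -
      define f where "f = 1 / area K * flux_sum M (c n 1) K"
      define w where "w = 1 - 2 * c (n - 1) 1 K"
      have "\<mu> n 1 K - \<mu> n 2 K = \<alpha> * f + \<kappa> * w"
        using chemical_potential[OF n K] by (simp add: f_def w_def)
      moreover have "(\<alpha> * f + \<kappa> * w)\<^sup>2 \<le> 2 * \<alpha>\<^sup>2 * f\<^sup>2 + 2 * \<kappa>\<^sup>2 * w\<^sup>2"
      proof -
        have "0 \<le> (\<alpha> * f - \<kappa> * w)\<^sup>2" by simp
        then show ?thesis by (simp add: power2_eq_square algebra_simps)
      qed
      moreover have "2 * \<kappa>\<^sup>2 * w\<^sup>2 \<le> 2 * \<kappa>\<^sup>2 * 1"
        using centred_conc_square_le[of "n - 1" K] n K by (intro mult_left_mono) (auto simp: w_def)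
      ultimately have "(\<mu> n 1 K - \<mu> n 2 K)\<^sup>2 \<le> 2 * \<alpha>\<^sup>2 * f\<^sup>2 + 2 * \<kappa>\<^sup>2" by simp
      then have "area K * (\<mu> n 1 K - \<mu> n 2 K)\<^sup>2 \<le> area K * (2 * \<alpha>\<^sup>2 * f\<^sup>2 + 2 * \<kappa>\<^sup>2)"
        by (intro mult_left_mono) auto
      then show ?thesis unfolding f_def[symmetric] by (simp add: algebra_simps)
    qed
    then have "(\<Sum>K\<in>cells M. area K * (\<mu> n 1 K - \<mu> n 2 K)\<^sup>2) \<le>
      (\<Sum>K\<in>cells M. 2 * \<alpha>\<^sup>2 * (area K * (1 / area K * flux_sum M (c n 1) K)\<^sup>2) + 2 * \<kappa>\<^sup>2 * area K)"
      by (rule sum_mono)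
    then show ?thesis
      by (simp only: sum.distrib laplacian_energy_def sum_distrib_left flip: sum_area)
  qed
  then have "(\<Sum>n=1..N. dt * (\<Sum>K\<in>cells M. area K * (\<mu> n 1 K - \<mu> n 2 K)\<^sup>2)) \<le>
      (\<Sum>n=1..N. dt * (2 * \<alpha>\<^sup>2 * laplacian_energy n + 2 * \<kappa>\<^sup>2 * area \<Omega>))"
    using dt(1) by (intro sum_mono mult_left_mono) auto
  also have "\<dots> = 2 * \<alpha>\<^sup>2 * (\<Sum>n=1..N. dt * laplacian_energy n) + 2 * \<kappa>\<^sup>2 * (real N * dt) * area \<Omega>"
    by (simp add: sum.distrib sum_distrib_left algebra_simps)
  also have "\<dots> = 2 * \<alpha>\<^sup>2 * (\<Sum>n=1..N. dt * laplacian_energy n) + 2 * \<kappa>\<^sup>2 * T * area \<Omega>"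
    by (simp only: dt(2))
  also have "\<dots> \<le> 2 * \<alpha>\<^sup>2 * ((2 / \<alpha> + 1) * entropy_budget) + 2 * \<kappa>\<^sup>2 * T * area \<Omega>"
  proof -
    have "0 \<le> (\<Sum>n=1..N. dt * fisher_information n)"
      using dt(1) fisher_information_nonneg by (intro sum_nonneg) simp
    then have "(\<Sum>n=1..N. dt * laplacian_energy n) \<le> (2 / \<alpha> + 1) * entropy_budget"
      using fisher_laplacian_bound by linarith
    then show ?thesis by (intro add_right_mono mult_left_mono) auto
  qed
  finally show ?thesis .
qed

end

theorem lemma3p5:
  fixes \<Omega> :: "plane set" and T \<alpha> \<kappa> \<zeta> :: real
    and \<eta> \<theta> :: "nat \<Rightarrow> real" and \<Psi> :: "nat \<Rightarrow> plane \<Rightarrow> real" and c10 :: "plane \<Rightarrow> real"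
  assumes "open \<Omega>" and "bounded \<Omega>" and "connected \<Omega>" and "polygonal \<Omega>"
    and "T > 0" and "\<alpha> > 0" and "\<kappa> > 0" and "\<zeta> > 1"
    and "\<forall>i\<in>{1,2}. \<eta> i > 0 \<and> \<theta> i \<ge> 0 \<and> H1 \<Omega> (\<Psi> i)"
  shows
    "(\<exists>C_FI. \<forall>\<rho> c0 M N c \<mu>.
        \<rho> > 0 \<and> c0 1 = c10 \<and> initial_data \<Omega> c0 \<and>
        admissible_mesh \<Omega> M \<and> regular_mesh \<zeta> M \<and> N \<ge> 1 \<and>
        scheme_solution M T N \<alpha> \<kappa> \<rho> \<eta> \<theta> \<Psi> c0 c \<mu> \<longrightarrow>
        (\<Sum>n=1..N. T / real N *
           (\<Sum>K\<in>cells M. area K * (1 / area K * flux_sum M (c n 1) K)\<^sup>2)) +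
        (\<Sum>n=1..N. T / real N *
           (\<Sum>i\<in>{1,2}. \<eta> i * theta_mesh M \<rho> (\<theta> i) *
              (\<Sum>\<sigma>\<in>interior_edges M. case edge_cells M \<sigma> of (K, L) \<Rightarrow>
                 transmissivity M \<sigma> * (c n i K - c n i L) * (ln (c n i K) - ln (c n i L)))))
        \<le> C_FI) \<and>
     (\<exists>C. \<forall>\<rho> c0 M N c \<mu>.
        \<rho> > 0 \<and> c0 1 = c10 \<and> initial_data \<Omega> c0 \<and>
        admissible_mesh \<Omega> M \<and> regular_mesh \<zeta> M \<and> N \<ge> 1 \<and>
        scheme_solution M T N \<alpha> \<kappa> \<rho> \<eta> \<theta> \<Psi> c0 c \<mu> \<longrightarrow>
        (\<Sum>n=1..N. T / real N *
           (\<Sum>K\<in>cells M. area K * (\<mu> n 1 K - \<mu> n 2 K)\<^sup>2)) \<le> C)"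
proof -
  \<comment> \<open>The constants must be fixed before the mesh and the solution, so \<open>entropy_budget\<close> is
      written out here in terms of the data alone.\<close>
  define Q where "Q = 2 * ((LINT x:\<Omega>|lebesgue. (\<Psi> 1 x)\<^sup>2) + (LINT x:\<Omega>|lebesgue. (\<Psi> 2 x)\<^sup>2))"
  define B where "B = (\<eta> 1 + \<eta> 2) * area \<Omega> + T * ((\<kappa>\<^sup>2 * area \<Omega> + Q) / \<alpha>)"
  have sol: "discrete_solution \<Omega> M T \<alpha> \<kappa> \<rho> N \<eta> \<theta> \<Psi> c0 c \<mu>"
    if "\<rho> > 0 \<and> c0 1 = c10 \<and> initial_data \<Omega> c0 \<and> admissible_mesh \<Omega> M \<and> regular_mesh \<zeta> M \<and> N \<ge> 1 \<and>
        scheme_solution M T N \<alpha> \<kappa> \<rho> \<eta> \<theta> \<Psi> c0 c \<mu>" for \<rho> c0 M N c \<mu>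
    using that assms by unfold_locales (auto simp: H1_def)
  show ?thesis
  proof (intro conjI exI allI impI)
    fix \<rho> c0 M N c \<mu>
    assume *: "\<rho> > 0 \<and> c0 1 = c10 \<and> initial_data \<Omega> c0 \<and> admissible_mesh \<Omega> M \<and> regular_mesh \<zeta> M \<and> N \<ge> 1 \<and>
        scheme_solution M T N \<alpha> \<kappa> \<rho> \<eta> \<theta> \<Psi> c0 c \<mu>"
    interpret discrete_solution \<Omega> M T \<alpha> \<kappa> \<rho> N \<eta> \<theta> \<Psi> c0 c \<mu> by (rule sol[OF *])
    have B: "B = entropy_budget" by (simp add: B_def Q_def entropy_budget_def potential_norm_def)
    show "(\<Sum>n=1..N. T / real N *
           (\<Sum>K\<in>cells M. area K * (1 / area K * flux_sum M (c n 1) K)\<^sup>2)) +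
        (\<Sum>n=1..N. T / real N *
           (\<Sum>i\<in>{1,2}. \<eta> i * theta_mesh M \<rho> (\<theta> i) *
              (\<Sum>\<sigma>\<in>interior_edges M. case edge_cells M \<sigma> of (K, L) \<Rightarrow>
                 transmissivity M \<sigma> * (c n i K - c n i L) * (ln (c n i K) - ln (c n i L)))))
        \<le> (2 / \<alpha> + 1) * B"
      using fisher_laplacian_bound
      by (simp only: B dt_def laplacian_energy_def fisher_information_def fisher_def edge_sum_def)
    show "(\<Sum>n=1..N. T / real N *
           (\<Sum>K\<in>cells M. area K * (\<mu> n 1 K - \<mu> n 2 K)\<^sup>2))
        \<le> 2 * \<alpha>\<^sup>2 * ((2 / \<alpha> + 1) * B) + 2 * \<kappa>\<^sup>2 * T * area \<Omega>"
      using potential_gap_bound by (simp only: B dt_def)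
  qed
qed

end
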